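(* Let $t\mapsto J_t$ ($t\in[0,1]$) be a smooth family of generalized complex structures on a Courant algebroid $E$, with $+i$-eigenbundles $L_t\subset E\otimes\mathbb{C}$, and let $\dot\omega_t\in\Gamma(\wedge^2L_t^* )$ be defined by $\dot\omega_t(v,w)=\langle v,\dot J_tw\rangle$ for $v,w\in\Gamma(L_t)$, where $\dot J_t=\frac{d}{dt}J_t$. Let $t\mapsto\beta_t\in\Gamma(L_t^* )$ be a smooth path, let $z_t\in\Gamma(L_t)$ be the unique section such that $\beta_t=\langle\overline{z_t},\cdot\rangle$, and let $x_t=\frac{1}{2i}(z_t-\overline{z_t})\in\Gamma(E)$ be its imaginary part. Then $$\dot\omega_t=d_{L_t}\beta_t\quad\text{for all }t$$ if, and only if, $$\dot J_t+\mathcal{L}_{x_t}J_t=0\quad\text{for all }t.$$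
   Context: A Courant algebroid is a vector bundle $E\to M$ with a non-degenerate symmetric bilinear form $\langle\cdot,\cdot\rangle$, a skew-symmetric bracket $[\![\cdot,\cdot]\!]$ on $\Gamma(E)$ and a smooth bundle map $\rho:E\to TM$ (the anchor), such that, with $\mathcal{D}:C^\infty(M)\to\Gamma(E)$ defined by $\langle\mathcal{D}f,a\rangle=\frac12\rho(a)f$, one has for all $a,b,c\in\Gamma(E)$, $f,g\in C^\infty(M)$: (i) $\rho([\![a,b]\!])=[\rho(a),\rho(b)]$; (ii) $[\![[\![a,b]\!],c]\!]+[\![[\![b,c]\!],a]\!]+[\![[\![c,a]\!],b]\!]=\frac13\mathcal{D}\big(\langle[\![a,b]\!],c\rangle+\langle[\![b,c]\!],a\rangle+\langle[\![c,a]\!],b\rangle\big)$; (iii) $[\![a,fb]\!]=f[\![a,b]\!]+(\rho(a)f)b-\langle a,b\rangle\mathcal{D}f$; (iv) $\rho\circ\mathcal{D}=0$, i.e. $\langle\mathcal{D}f,\mathcal{D}g\rangle=0$; (v) $\rho(a)\langle b,c\rangle=\langle[\![a,b]\!]+\mathcal{D}\langle a,b\rangle,c\rangle+\langle b,[\![a,c]\!]+\mathcal{D}\langle a,c\rangle\rangle$. A generalized complex structure on $E$ is a vector bundle map $J:E\to E$ over $\mathrm{id}_M$ with $J^2=-\mathrm{id}$, orthogonal for $\langle\cdot,\cdot\rangle$, and integrable: $[\![Jx,Jy]\!]-[\![x,y]\!]-J([\![Jx,y]\!]+[\![x,Jy]\!])=0$ for all $x,y\in\Gamma(E)$. The structure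 of $E$ is extended $\mathbb{C}$-linearly to $E\otimes\mathbb{C}=L\oplus\overline L$, with $L$ (resp. $\overline L$) the $+i$- (resp. $-i$-) eigenbundle. $L$ is isotropic and $\Gamma(L)$ is closed under the bracket, so $L$ is a complex Lie algebroid with anchor $\rho|_L$ and bracket $[\![\cdot,\cdot]\!]$; $d_L$ denotes its Lie algebroid differential, so $(d_L\beta)(v,w)=\rho(v)\beta(w)-\rho(w)\beta(v)-\beta([\![v,w]\!])$ for $\beta\in\Gamma(L^* )$. The pairing identifies $\overline L\simeq L^*$ by $e\mapsto\langle e,\cdot\rangle$; smoothness in $t$ of $\beta_t$ means smoothness of the corresponding sections of $E\otimes\mathbb{C}$. Lie derivative: for $x,y\in\Gamma(E)$, $\mathcal{L}_xy=[\![x,y]\!]+\mathcal{D}\langle x,y\rangle$ (the Dorfman bracket), and for a bundle map $J:E\to E$ over the identity, $(\mathcal{L}_xJ)(y)=\mathcal{L}_x(J(y))-J(\mathcal{L}_xy)$. *)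

theory Defs
  imports "HOL-Analysis.Analysis"
begin

section \<open>Smooth functions\<close>

text \<open>\<open>C\<^sup>k\<close> functions on an open subset \<open>U\<close> of a Euclidean space.\<close>

primrec Ck_on :: "nat \<Rightarrow> 'a::euclidean_space set \<Rightarrow> ('a \<Rightarrow> 'c::real_normed_vector) \<Rightarrow> bool" where
  "Ck_on 0 U f \<longleftrightarrow> continuous_on U f"
| "Ck_on (Suc k) U f \<longleftrightarrow>
     (\<forall>x\<in>U. f differentiable (at x)) \<and>
     (\<forall>v. Ck_on k U (\<lambda>x. frechet_derivative f (at x) v))"

text \<open>On an arbitrary subset, smooth means locally the restriction of a smooth function on an
  open set. This is used for open subsets of a linear subspace, and for products of such
  sets with the closed interval \<open>{0..1}\<close>.\<close>

definition smooth_on :: "'a::euclidean_space set \<Rightarrow> ('a \<Rightarrow> 'c::real_normed_vector) \<Rightarrow> bool" where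
  "smooth_on S f \<longleftrightarrow>
     (\<forall>x\<in>S. \<exists>U g. open U \<and> x \<in> U \<and> (\<forall>k. Ck_on k U g) \<and> (\<forall>y\<in>S \<inter> U. g y = f y))"


section \<open>Manifolds\<close>

text \<open>The underlying space is the whole type \<open>'m\<close>. Charts take values in a linear subspace
  \<open>model\<close> of \<open>'b\<close> (rather than in \<open>'b\<close>, whose dimension is positive) so that manifolds of
  dimension 0 are included.\<close>

record ('m, 'b) manifold =
  model :: "'b set"
  atlas :: "('m set \<times> ('m \<Rightarrow> 'b)) set"

locale smooth_manifold =
  fixes X :: "('m::{t2_space, second_countable_topology}, 'b::euclidean_space, 'z) manifold_scheme"
  assumes model_subspace: "subspace (model X)"
    and chart_open: "(W, \<phi>) \<in> atlas X \<Longrightarrow> open W"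
    and chart_image: "(W, \<phi>) \<in> atlas X \<Longrightarrow> openin (top_of_set (model X)) (\<phi> ` W)"
    and chart_homeomorphism:
      "(W, \<phi>) \<in> atlas X \<Longrightarrow> homeomorphism W (\<phi> ` W) \<phi> (inv_into W \<phi>)"
    and charts_cover: "(\<Union>(W, \<phi>)\<in>atlas X. W) = UNIV"
    and chart_transition:
      "(W, \<phi>) \<in> atlas X \<Longrightarrow> (W', \<phi>') \<in> atlas X \<Longrightarrow>
         smooth_on (\<phi> ` (W \<inter> W')) (\<phi>' \<circ> inv_into W \<phi>)"

text \<open>In the next two definitions \<open>U\<close> is meant to be open.\<close>

definition smooth_fun ::
  "('m, 'b::euclidean_space, 'z) manifold_scheme \<Rightarrow> 'm set \<Rightarrow> ('m \<Rightarrow> 'c::real_normed_vector) \<Rightarrow> bool"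
where
  "smooth_fun X U f \<longleftrightarrow>
     (\<forall>(W, \<phi>)\<in>atlas X. smooth_on (\<phi> ` (U \<inter> W)) (f \<circ> inv_into W \<phi>))"

text \<open>Joint smoothness of \<open>(t, p) \<mapsto> f t p\<close> on \<open>[0,1] \<times> U\<close>.\<close>

definition smooth_fun_path ::
  "('m, 'b::euclidean_space, 'z) manifold_scheme \<Rightarrow> 'm set \<Rightarrow> (real \<Rightarrow> 'm \<Rightarrow> real) \<Rightarrow> bool"
where
  "smooth_fun_path X U f \<longleftrightarrow>
     (\<forall>(W, \<phi>)\<in>atlas X.
        smooth_on ({0..1} \<times> \<phi> ` (U \<inter> W)) (\<lambda>(t, x). f t (inv_into W \<phi> x)))"

text \<open>The tangent space at \<open>p\<close> as the space of derivations of \<open>C\<^sup>\<infinity>(M)\<close> at \<open>p\<close>; off the smooth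
  functions a tangent vector is 0 by convention.\<close>

definition tangent_space ::
  "('m, 'b::euclidean_space, 'z) manifold_scheme \<Rightarrow> 'm \<Rightarrow> (('m \<Rightarrow> real) \<Rightarrow> real) set"
where
  "tangent_space X p = {\<xi>.
     (\<forall>f g. smooth_fun X UNIV f \<longrightarrow> smooth_fun X UNIV g \<longrightarrow>
        \<xi> (\<lambda>q. f q + g q) = \<xi> f + \<xi> g \<and>
        \<xi> (\<lambda>q. f q * g q) = f p * \<xi> g + g p * \<xi> f) \<and>
     (\<forall>c f. smooth_fun X UNIV f \<longrightarrow> \<xi> (\<lambda>q. c * f q) = c * \<xi> f) \<and>
     (\<forall>f. \<not> smooth_fun X UNIV f \<longrightarrow> \<xi> f = 0)}"

definition lie_bracket ::
  "('m \<Rightarrow> ('m \<Rightarrow> real) \<Rightarrow> real) \<Rightarrow> ('m \<Rightarrow> ('m \<Rightarrow> real) \<Rightarrow> real) \<Rightarrow> 'm \<Rightarrow> ('m \<Rightarrow> real) \<Rightarrow> real"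
where
  "lie_bracket \<xi> \<eta> p f = \<xi> p (\<lambda>q. \<eta> q f) - \<eta> p (\<lambda>q. \<xi> q f)"


section \<open>Vector bundles\<close>

text \<open>The fibres are finite-dimensional linear subspaces of a common real vector space type \<open>'e\<close>.
  This is no restriction, since an arbitrary family of vector spaces embeds in its direct sum.
  The norm on \<open>'e\<close> only serves to differentiate curves inside a single fibre, whose topology
  does not depend on the norm.

  The smooth structure is given by local trivializations in the form of local frames
  \<open>(W, k, b)\<close>: an open set \<open>W\<close>, the rank \<open>k\<close> over \<open>W\<close>, and \<open>b 0, \<dots>, b (k - 1)\<close> forming a basis
  of the fibre at each point of \<open>W\<close>.\<close>

record ('m, 'b, 'e) vbundle = "('m, 'b) manifold" +
  fibre :: "'m \<Rightarrow> 'e set"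
  frames :: "('m set \<times> nat \<times> (nat \<Rightarrow> 'm \<Rightarrow> 'e)) set"

definition sections ::
  "('m, 'b::euclidean_space, 'e::real_vector, 'z) vbundle_scheme \<Rightarrow> 'm set \<Rightarrow> ('m \<Rightarrow> 'e) set"
where
  "sections X U = {s.
     (\<forall>p\<in>U. s p \<in> fibre X p) \<and>
     (\<forall>(W, k, b)\<in>frames X. \<exists>c.
        (\<forall>i<k. smooth_fun X (U \<inter> W) (c i :: 'm \<Rightarrow> real)) \<and>
        (\<forall>p\<in>U \<inter> W. s p = (\<Sum>i<k. c i p *\<^sub>R b i p)))}"

abbreviation global_sections ::
  "('m, 'b::euclidean_space, 'e::real_vector, 'z) vbundle_scheme \<Rightarrow> ('m \<Rightarrow> 'e) set"
where "global_sections X \<equiv> sections X UNIV"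

definition section_paths ::
  "('m, 'b::euclidean_space, 'e::real_vector, 'z) vbundle_scheme \<Rightarrow> 'm set \<Rightarrow> (real \<Rightarrow> 'm \<Rightarrow> 'e) set"
where
  "section_paths X U = {s.
     (\<forall>t\<in>{0..1}. \<forall>p\<in>U. s t p \<in> fibre X p) \<and>
     (\<forall>(W, k, b)\<in>frames X. \<exists>c.
        (\<forall>i<k. smooth_fun_path X (U \<inter> W) (c i)) \<and>
        (\<forall>t\<in>{0..1}. \<forall>p\<in>U \<inter> W. s t p = (\<Sum>i<k. c i t p *\<^sub>R b i p)))}"

locale vector_bundle = smooth_manifold X
  for X :: "('m::{t2_space, second_countable_topology}, 'b::euclidean_space,
             'e::real_normed_vector, 'z) vbundle_scheme" +
  assumes frame_open: "(W, k, b) \<in> frames X \<Longrightarrow> open W"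
    and frame_basis:
      "(W, k, b) \<in> frames X \<Longrightarrow> p \<in> W \<Longrightarrow>
         inj_on (\<lambda>i. b i p) {..<k} \<and> independent ((\<lambda>i. b i p) ` {..<k}) \<and>
         span ((\<lambda>i. b i p) ` {..<k}) = fibre X p"
    and frames_cover: "(\<Union>(W, k, b)\<in>frames X. W) = UNIV"
    and frame_transition: "(W, k, b) \<in> frames X \<Longrightarrow> i < k \<Longrightarrow> b i \<in> sections X W"

text \<open>Smoothness of a bundle map is tested on local sections over arbitrary open sets
  (in particular on local frames).\<close>

definition bundle_endomorphism ::
  "('m::topological_space, 'b::euclidean_space, 'e::real_vector, 'z) vbundle_scheme \<Rightarrow>
     ('m \<Rightarrow> 'e \<Rightarrow> 'e) \<Rightarrow> bool"
where
  "bundle_endomorphism X J \<longleftrightarrow>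
     (\<forall>p. \<forall>u\<in>fibre X p. J p u \<in> fibre X p) \<and>
     (\<forall>p. \<forall>u\<in>fibre X p. \<forall>v\<in>fibre X p. J p (u + v) = J p u + J p v) \<and>
     (\<forall>p. \<forall>u\<in>fibre X p. \<forall>r. J p (r *\<^sub>R u) = r *\<^sub>R J p u) \<and>
     (\<forall>U. open U \<longrightarrow> (\<forall>s\<in>sections X U. (\<lambda>p. J p (s p)) \<in> sections X U))"

definition smooth_endomorphism_family ::
  "('m::topological_space, 'b::euclidean_space, 'e::real_vector, 'z) vbundle_scheme \<Rightarrow>
     (real \<Rightarrow> 'm \<Rightarrow> 'e \<Rightarrow> 'e) \<Rightarrow> bool"
where
  "smooth_endomorphism_family X J \<longleftrightarrow>
     (\<forall>t\<in>{0..1}. bundle_endomorphism X (J t)) \<and>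
     (\<forall>U. open U \<longrightarrow> (\<forall>s\<in>sections X U. (\<lambda>t p. J t p (s p)) \<in> section_paths X U))"

text \<open>\<open>dJ/dt\<close>, computed in each fibre and one-sided at the end points of \<open>[0,1]\<close>.\<close>

definition time_deriv :: "(real \<Rightarrow> 'm \<Rightarrow> 'e \<Rightarrow> 'e::real_normed_vector) \<Rightarrow> real \<Rightarrow> 'm \<Rightarrow> 'e \<Rightarrow> 'e" where
  "time_deriv J t p u = vector_derivative (\<lambda>s. J s p u) (at t within {0..1})"


section \<open>Courant algebroids\<close>

text \<open>The anchor sends \<open>u\<close> in the fibre at \<open>p\<close> to a tangent vector at \<open>p\<close>, i.e. a derivation.\<close>

record ('m, 'b, 'e) courant = "('m, 'b, 'e) vbundle" +
  pairing :: "'m \<Rightarrow> 'e \<Rightarrow> 'e \<Rightarrow> real"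
  bracket :: "('m \<Rightarrow> 'e) \<Rightarrow> ('m \<Rightarrow> 'e) \<Rightarrow> 'm \<Rightarrow> 'e"
  anchor :: "'m \<Rightarrow> 'e \<Rightarrow> ('m \<Rightarrow> real) \<Rightarrow> real"

text \<open>\<open>\<langle>Df, a\<rangle> = \<rho>(a)f / 2\<close> determines \<open>Df\<close> fibrewise, by nondegeneracy of the pairing.\<close>

definition courant_D ::
  "('m, 'b, 'e::real_vector, 'z) courant_scheme \<Rightarrow> ('m \<Rightarrow> real) \<Rightarrow> 'm \<Rightarrow> 'e"
where
  "courant_D X f p =
     (THE e. e \<in> fibre X p \<and> (\<forall>a\<in>fibre X p. pairing X p e a = 1/2 * anchor X p a f))"

definition pairing_sec ::
  "('m, 'b, 'e, 'z) courant_scheme \<Rightarrow> ('m \<Rightarrow> 'e) \<Rightarrow> ('m \<Rightarrow> 'e) \<Rightarrow> 'm \<Rightarrow> real"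
where "pairing_sec X a b p = pairing X p (a p) (b p)"

definition anchor_sec ::
  "('m, 'b, 'e, 'z) courant_scheme \<Rightarrow> ('m \<Rightarrow> 'e) \<Rightarrow> 'm \<Rightarrow> ('m \<Rightarrow> real) \<Rightarrow> real"
where "anchor_sec X a p f = anchor X p (a p) f"

locale courant_algebroid = vector_bundle X
  for X :: "('m::{t2_space, second_countable_topology}, 'b::euclidean_space,
             'e::real_normed_vector, 'z) courant_scheme" +
  assumes pairing_sym:
      "u \<in> fibre X p \<Longrightarrow> v \<in> fibre X p \<Longrightarrow> pairing X p u v = pairing X p v u"
    and pairing_add:
      "u \<in> fibre X p \<Longrightarrow> v \<in> fibre X p \<Longrightarrow> w \<in> fibre X p \<Longrightarrow>
         pairing X p (u + v) w = pairing X p u w + pairing X p v w"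
    and pairing_scale:
      "u \<in> fibre X p \<Longrightarrow> v \<in> fibre X p \<Longrightarrow> pairing X p (r *\<^sub>R u) v = r * pairing X p u v"
    and pairing_nondegenerate:
      "u \<in> fibre X p \<Longrightarrow> (\<And>v. v \<in> fibre X p \<Longrightarrow> pairing X p u v = 0) \<Longrightarrow> u = 0"
    and pairing_smooth:
      "open U \<Longrightarrow> a \<in> sections X U \<Longrightarrow> b \<in> sections X U \<Longrightarrow> smooth_fun X U (pairing_sec X a b)"
    and anchor_tangent: "u \<in> fibre X p \<Longrightarrow> anchor X p u \<in> tangent_space X p"
    and anchor_add:
      "u \<in> fibre X p \<Longrightarrow> v \<in> fibre X p \<Longrightarrow>
         anchor X p (u + v) f = anchor X p u f + anchor X p v f"
    and anchor_scale: "u \<in> fibre X p \<Longrightarrow> anchor X p (r *\<^sub>R u) f = r * anchor X p u f"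
    and anchor_smooth:
      "open U \<Longrightarrow> a \<in> sections X U \<Longrightarrow> smooth_fun X UNIV f \<Longrightarrow>
         smooth_fun X U (\<lambda>p. anchor_sec X a p f)"
    and bracket_section:
      "a \<in> global_sections X \<Longrightarrow> b \<in> global_sections X \<Longrightarrow> bracket X a b \<in> global_sections X"
    and bracket_skew:
      "a \<in> global_sections X \<Longrightarrow> b \<in> global_sections X \<Longrightarrow> bracket X a b p = - bracket X b a p"
    and bracket_add:
      "a \<in> global_sections X \<Longrightarrow> b \<in> global_sections X \<Longrightarrow> c \<in> global_sections X \<Longrightarrow>
         bracket X (\<lambda>q. a q + b q) c p = bracket X a c p + bracket X b c p"
    and bracket_scale:
      "a \<in> global_sections X \<Longrightarrow> b \<in> global_sections X \<Longrightarrow>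
         bracket X (\<lambda>q. r *\<^sub>R a q) b p = r *\<^sub>R bracket X a b p"
    and anchor_bracket:
      "a \<in> global_sections X \<Longrightarrow> b \<in> global_sections X \<Longrightarrow> smooth_fun X UNIV f \<Longrightarrow>
         anchor_sec X (bracket X a b) p f = lie_bracket (anchor_sec X a) (anchor_sec X b) p f"
    and jacobi:
      "a \<in> global_sections X \<Longrightarrow> b \<in> global_sections X \<Longrightarrow> c \<in> global_sections X \<Longrightarrow>
         bracket X (bracket X a b) c p + bracket X (bracket X b c) a p + bracket X (bracket X c a) b p
           = (1/3) *\<^sub>R courant_D X (\<lambda>q. pairing_sec X (bracket X a b) c q
               + pairing_sec X (bracket X b c) a q + pairing_sec X (bracket X c a) b q) p"
    and leibniz:
      "a \<in> global_sections X \<Longrightarrow> b \<in> global_sections X \<Longrightarrow> smooth_fun X UNIV f \<Longrightarrow>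
         bracket X a (\<lambda>q. f q *\<^sub>R b q) p
           = f p *\<^sub>R bracket X a b p + anchor_sec X a p f *\<^sub>R b p
               - pairing_sec X a b p *\<^sub>R courant_D X f p"
    and anchor_D:
      "smooth_fun X UNIV f \<Longrightarrow> smooth_fun X UNIV g \<Longrightarrow> anchor_sec X (courant_D X f) p g = 0"
    and pairing_invariant:
      "a \<in> global_sections X \<Longrightarrow> b \<in> global_sections X \<Longrightarrow> c \<in> global_sections X \<Longrightarrow>
         anchor_sec X a p (pairing_sec X b c)
           = pairing X p (bracket X a b p + courant_D X (pairing_sec X a b) p) (c p)
           + pairing X p (b p) (bracket X a c p + courant_D X (pairing_sec X a c) p)"

definition generalized_complex ::
  "('m::topological_space, 'b::euclidean_space, 'e::real_vector, 'z) courant_scheme \<Rightarrow>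
     ('m \<Rightarrow> 'e \<Rightarrow> 'e) \<Rightarrow> bool"
where
  "generalized_complex X J \<longleftrightarrow>
     bundle_endomorphism X J \<and>
     (\<forall>p. \<forall>u\<in>fibre X p. J p (J p u) = - u) \<and>
     (\<forall>p. \<forall>u\<in>fibre X p. \<forall>v\<in>fibre X p. pairing X p (J p u) (J p v) = pairing X p u v) \<and>
     (\<forall>x\<in>global_sections X. \<forall>y\<in>global_sections X. \<forall>p.
        bracket X (\<lambda>q. J q (x q)) (\<lambda>q. J q (y q)) p - bracket X x y p
          - J p (bracket X (\<lambda>q. J q (x q)) y p + bracket X x (\<lambda>q. J q (y q)) p) = 0)"

definition lie_deriv ::
  "('m, 'b, 'e::real_vector, 'z) courant_scheme \<Rightarrow> ('m \<Rightarrow> 'e) \<Rightarrow> ('m \<Rightarrow> 'e) \<Rightarrow> 'm \<Rightarrow> 'e"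
where
  "lie_deriv X x y p = bracket X x y p + courant_D X (pairing_sec X x y) p"

definition lie_deriv_endo ::
  "('m, 'b, 'e::real_vector, 'z) courant_scheme \<Rightarrow> ('m \<Rightarrow> 'e) \<Rightarrow> ('m \<Rightarrow> 'e \<Rightarrow> 'e) \<Rightarrow>
     ('m \<Rightarrow> 'e) \<Rightarrow> 'm \<Rightarrow> 'e"
where
  "lie_deriv_endo X x J y p = lie_deriv X x (\<lambda>q. J q (y q)) p - J p (lie_deriv X x y p)"


section \<open>Complexification\<close>

text \<open>A vector \<open>u + i v\<close> of the complexified fibre is the pair \<open>(u, v)\<close>. Everything is extended
  complex (bi)linearly.\<close>

definition cscale :: "complex \<Rightarrow> 'e \<times> 'e \<Rightarrow> 'e \<times> 'e::real_vector" where
  "cscale c e = (Re c *\<^sub>R fst e - Im c *\<^sub>R snd e, Re c *\<^sub>R snd e + Im c *\<^sub>R fst e)"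

definition cconj :: "'e \<times> 'e \<Rightarrow> 'e \<times> 'e::real_vector" where
  "cconj e = (fst e, - snd e)"

definition cembed :: "'e \<Rightarrow> 'e \<times> 'e::real_vector" where
  "cembed u = (u, 0)"

definition cext :: "('e \<Rightarrow> 'e) \<Rightarrow> 'e \<times> 'e \<Rightarrow> 'e \<times> 'e" where
  "cext A e = (A (fst e), A (snd e))"

definition cfibre :: "('m, 'b, 'e, 'z) vbundle_scheme \<Rightarrow> 'm \<Rightarrow> ('e \<times> 'e) set" where
  "cfibre X p = fibre X p \<times> fibre X p"

definition csections ::
  "('m, 'b::euclidean_space, 'e::real_vector, 'z) vbundle_scheme \<Rightarrow> 'm set \<Rightarrow> ('m \<Rightarrow> 'e \<times> 'e) set"
where
  "csections X U = {s. fst \<circ> s \<in> sections X U \<and> snd \<circ> s \<in> sections X U}"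

definition csection_paths ::
  "('m, 'b::euclidean_space, 'e::real_vector, 'z) vbundle_scheme \<Rightarrow> 'm set \<Rightarrow>
     (real \<Rightarrow> 'm \<Rightarrow> 'e \<times> 'e) set"
where
  "csection_paths X U =
     {s. (\<lambda>t p. fst (s t p)) \<in> section_paths X U \<and> (\<lambda>t p. snd (s t p)) \<in> section_paths X U}"

definition cpairing ::
  "('m, 'b, 'e, 'z) courant_scheme \<Rightarrow> 'm \<Rightarrow> 'e \<times> 'e \<Rightarrow> 'e \<times> 'e \<Rightarrow> complex"
where
  "cpairing X p e e' =
     Complex (pairing X p (fst e) (fst e') - pairing X p (snd e) (snd e'))
             (pairing X p (fst e) (snd e') + pairing X p (snd e) (fst e'))"

definition cbracket ::
  "('m, 'b, 'e::real_vector, 'z) courant_scheme \<Rightarrow> ('m \<Rightarrow> 'e \<times> 'e) \<Rightarrow> ('m \<Rightarrow> 'e \<times> 'e) \<Rightarrow> 'm \<Rightarrow> 'e \<times> 'e"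
where
  "cbracket X s s' p =
     (bracket X (fst \<circ> s) (fst \<circ> s') p - bracket X (snd \<circ> s) (snd \<circ> s') p,
      bracket X (fst \<circ> s) (snd \<circ> s') p + bracket X (snd \<circ> s) (fst \<circ> s') p)"

definition canchor_sec ::
  "('m, 'b, 'e, 'z) courant_scheme \<Rightarrow> ('m \<Rightarrow> 'e \<times> 'e) \<Rightarrow> 'm \<Rightarrow> ('m \<Rightarrow> complex) \<Rightarrow> complex"
where
  "canchor_sec X s p f =
     Complex (anchor_sec X (fst \<circ> s) p (Re \<circ> f) - anchor_sec X (snd \<circ> s) p (Im \<circ> f))
             (anchor_sec X (fst \<circ> s) p (Im \<circ> f) + anchor_sec X (snd \<circ> s) p (Re \<circ> f))"


section \<open>The eigenbundle of a generalized complex structure as a Lie algebroid\<close>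

definition eigenbundle ::
  "('m, 'b, 'e::real_vector, 'z) vbundle_scheme \<Rightarrow> ('m \<Rightarrow> 'e \<Rightarrow> 'e) \<Rightarrow> complex \<Rightarrow> 'm \<Rightarrow> ('e \<times> 'e) set"
where
  "eigenbundle X J c p = {e \<in> cfibre X p. cext (J p) e = cscale c e}"

abbreviation L_plus ("L\<^sub>+") where "L\<^sub>+ X J \<equiv> eigenbundle X J \<i>"

abbreviation L_minus ("L\<^sub>-") where "L\<^sub>- X J \<equiv> eigenbundle X J (- \<i>)"

definition L_sections ::
  "('m, 'b::euclidean_space, 'e::real_vector, 'z) vbundle_scheme \<Rightarrow> ('m \<Rightarrow> 'e \<Rightarrow> 'e) \<Rightarrow> 'm set \<Rightarrow>
     ('m \<Rightarrow> 'e \<times> 'e) set"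
where
  "L_sections X J U = {s \<in> csections X U. \<forall>p\<in>U. s p \<in> L\<^sub>+ X J p}"

text \<open>Smooth sections of \<open>L\<^sup>*\<close>; only the values of \<open>\<beta> p\<close> on \<open>L\<^sub>+ X J p\<close> are relevant.\<close>

definition L_dual_sections ::
  "('m::topological_space, 'b::euclidean_space, 'e::real_vector, 'z) vbundle_scheme \<Rightarrow>
     ('m \<Rightarrow> 'e \<Rightarrow> 'e) \<Rightarrow> ('m \<Rightarrow> 'e \<times> 'e \<Rightarrow> complex) set"
where
  "L_dual_sections X J = {\<beta>.
     (\<forall>p. \<forall>e\<in>L\<^sub>+ X J p. \<forall>e'\<in>L\<^sub>+ X J p. \<beta> p (e + e') = \<beta> p e + \<beta> p e') \<and>
     (\<forall>p. \<forall>e\<in>L\<^sub>+ X J p. \<forall>c. \<beta> p (cscale c e) = c * \<beta> p e) \<and>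
     (\<forall>U. open U \<longrightarrow> (\<forall>v\<in>L_sections X J U. smooth_fun X U (\<lambda>p. \<beta> p (v p))))}"

text \<open>Smooth paths \<open>t \<mapsto> \<beta>\<^sub>t \<in> \<Gamma>(L\<^sub>t\<^sup>*)\<close>. As \<open>L\<^sub>t\<close> varies with \<open>t\<close>, smoothness in \<open>t\<close> is that of
  the corresponding sections of the conjugate bundle of \<open>L\<^sub>t\<close> under \<open>e \<mapsto> \<langle>e, \<cdot>\<rangle>\<close>, regarded as
  sections of the complexified bundle.\<close>

definition L_dual_section_paths ::
  "('m::topological_space, 'b::euclidean_space, 'e::real_vector, 'z) courant_scheme \<Rightarrow>
     (real \<Rightarrow> 'm \<Rightarrow> 'e \<Rightarrow> 'e) \<Rightarrow> (real \<Rightarrow> 'm \<Rightarrow> 'e \<times> 'e \<Rightarrow> complex) set"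
where
  "L_dual_section_paths X J = {\<beta>.
     (\<forall>t\<in>{0..1}. \<beta> t \<in> L_dual_sections X (J t)) \<and>
     (\<exists>s\<in>csection_paths X UNIV. \<forall>t\<in>{0..1}. \<forall>p.
        s t p \<in> L\<^sub>- X (J t) p \<and> (\<forall>e\<in>L\<^sub>+ X (J t) p. \<beta> t p e = cpairing X p (s t p) e))}"

definition L_differential ::
  "('m, 'b, 'e::real_vector, 'z) courant_scheme \<Rightarrow> ('m \<Rightarrow> 'e \<times> 'e \<Rightarrow> complex) \<Rightarrow>
     ('m \<Rightarrow> 'e \<times> 'e) \<Rightarrow> ('m \<Rightarrow> 'e \<times> 'e) \<Rightarrow> 'm \<Rightarrow> complex"
where
  "L_differential X \<beta> v w p =
     canchor_sec X v p (\<lambda>q. \<beta> q (w q)) - canchor_sec X w p (\<lambda>q. \<beta> q (v q))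
       - \<beta> p (cbracket X v w p)"

definition omega_dot ::
  "('m, 'b, 'e::real_normed_vector, 'z) courant_scheme \<Rightarrow> (real \<Rightarrow> 'm \<Rightarrow> 'e \<Rightarrow> 'e) \<Rightarrow> real \<Rightarrow>
     ('m \<Rightarrow> 'e \<times> 'e) \<Rightarrow> ('m \<Rightarrow> 'e \<times> 'e) \<Rightarrow> 'm \<Rightarrow> complex"
where
  "omega_dot X J t v w p = cpairing X p (v p) (cext (time_deriv J t p) (w p))"

end

theory Submission
  imports Defs "HOL-Computational_Algebra.Polynomial"
begin

text \<open>Let \<open>A = dJ/dt + \<L>\<^sub>x J\<close>. For sections \<open>v, w\<close> of \<open>L\<close>, axiom (v) and the fact that \<open>L\<close> is
  isotropic and closed under the bracket give \<open>d\<^sub>L\<beta>(v, w) = \<langle>v, \<L>\<^sub>s w\<rangle>\<close> with \<open>s = cconj z\<close>, and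
  \<open>\<langle>v, (\<L>\<^sub>x J) w\<rangle> = - \<langle>v, \<L>\<^sub>s w\<rangle>\<close>. Hence the first equation says \<open>\<langle>v, A w\<rangle> = 0\<close> for all such
  \<open>v, w\<close>. As \<open>A\<close> anticommutes with \<open>J\<close>, inserting \<open>v = s - i J s\<close> and \<open>w = y - i J y\<close> for real
  sections \<open>s, y\<close> turns this into \<open>\<langle>s, A y\<rangle> = 0\<close>. Nondegeneracy then gives \<open>A y = 0\<close>, since bump
  functions extend every vector of a fibre to a global section.\<close>

section \<open>Smooth functions\<close>

text \<open>Both summands of A anticommute with J for the same reason: the time derivative and the
  Dorfman derivative along x act as derivations and kill J^2 = - id. With w = y - i J y one gets A w
  = A y + i J (A y), so the real part of the pairing with s - i J s is <s, A y> + <J s, J A y> = 2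
  <s, A y> by orthogonality. The section y is given throughout; only the test vector at p has to be
  extended, and to a global section, since the first equation speaks of global sections of L. This
  is the purpose of the analytic part. Two obstacles shape the rest. \<open>courant_D\<close> is a
  definite description, so D f can be used only once nondegeneracy is known to represent every
  functional on a fibre. And J_s (J_s u) depends on s twice; expanding J_s u in a frame turns its
  derivative into the product rule for finite sums.\<close>

lemma Ck_on_cong:
  assumes "open U" "\<And>x. x \<in> U \<Longrightarrow> f x = g x" "Ck_on k U f"
  shows "Ck_on k U g"
  using assms(2,3)
proof (induction k arbitrary: f g)
  case 0
  then show ?case
    using continuous_on_cong[of U U f g] by simp
next
  case (Suc k)
  \<comment> \<open>The derivative at x sees only values near x, and these are taken inside the open
    set U, where f and g agree.\<close>
  have g: "(g has_derivative frechet_derivative f (at x)) (at x)" if "x \<in> U" for x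
  proof (rule has_derivative_transform_within_open[OF _ assms(1) that])
    show "(f has_derivative frechet_derivative f (at x)) (at x)"
      using Suc.prems(2) that by (simp add: frechet_derivative_works[symmetric])
  qed (rule Suc.prems(1))
  have "frechet_derivative f (at x) = frechet_derivative g (at x)" if "x \<in> U" for x
    using frechet_derivative_at[OF g[OF that]] .
  then have "Ck_on k U (\<lambda>x. frechet_derivative g (at x) v)" for v
    using Suc.IH[of "\<lambda>x. frechet_derivative f (at x) v"] Suc.prems(2) by simp
  then show ?case
    using g by (auto simp: differentiable_def)
qed

text \<open>Lets the inductions below work with an explicit formula for the derivative in place of
  \<open>frechet_derivative\<close>.\<close>

lemma Ck_on_SucI:
  assumes "open U" "\<And>x. x \<in> U \<Longrightarrow> (f has_derivative f' x) (at x)"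
    and "\<And>v. Ck_on k U (\<lambda>x. f' x v)"
  shows "Ck_on (Suc k) U f"
proof -
  have "f' x = frechet_derivative f (at x)" if "x \<in> U" for x
    using frechet_derivative_at[OF assms(2)[OF that]] .
  then have "Ck_on k U (\<lambda>x. frechet_derivative f (at x) v)" for v
    by (intro Ck_on_cong[OF assms(1) _ assms(3)[of v]]) simp
  then show ?thesis
    using assms(2) by (auto simp: differentiable_def)
qed

text \<open>The last conclusion serves the product and chain rules, whose derivatives contain the
  undifferentiated functions again.\<close>

lemma Ck_on_SucD:
  assumes "Ck_on (Suc k) U f"
  shows "\<And>x. x \<in> U \<Longrightarrow> (f has_derivative frechet_derivative f (at x)) (at x)"
    and "\<And>v. Ck_on k U (\<lambda>x. frechet_derivative f (at x) v)"
    and "Ck_on k U f"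
proof -
  show "\<And>x. x \<in> U \<Longrightarrow> (f has_derivative frechet_derivative f (at x)) (at x)"
    and "\<And>v. Ck_on k U (\<lambda>x. frechet_derivative f (at x) v)"
    using assms by (auto simp: frechet_derivative_works[symmetric])
  show "Ck_on k U f"
    using assms
  proof (induction k arbitrary: f)
    case 0
    then show ?case
      by (auto intro!: continuous_at_imp_continuous_on differentiable_imp_continuous_within)
  next
    case (Suc k)
    then show ?case
      using Ck_on.simps(2)[of "Suc k" U f] Ck_on.simps(2)[of k U f] by blast
  qed
qed

lemma Ck_on_subset: "Ck_on k U f \<Longrightarrow> V \<subseteq> U \<Longrightarrow> Ck_on k V f"
  by (induction k arbitrary: f) (auto intro: continuous_on_subset)

lemma Ck_on_const: "open U \<Longrightarrow> Ck_on k U (\<lambda>x. c)"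
proof (induction k arbitrary: c)
  case (Suc k)
  then show ?case by (intro Ck_on_SucI[where f' = "\<lambda>_ _. 0"]) auto
qed simp

lemma Ck_on_bounded_linear:
  assumes "bounded_linear A" "open U" "Ck_on k U f"
  shows "Ck_on k U (\<lambda>x. A (f x))"
  using assms(3)
proof (induction k arbitrary: f)
  case 0
  then show ?case
    using bounded_linear.continuous_on[OF assms(1)] by simp
next
  case (Suc k)
  show ?case
    using Ck_on_SucD[OF Suc.prems] Suc.IH assms
    by (intro Ck_on_SucI[where f' = "\<lambda>x v. A (frechet_derivative f (at x) v)"])
      (auto intro: bounded_linear.has_derivative)
qed

lemma Ck_on_add:
  assumes "open U" "Ck_on k U f" "Ck_on k U g"
  shows "Ck_on k U (\<lambda>x. f x + g x)"
  using assms(2,3)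
proof (induction k arbitrary: f g)
  case 0
  then show ?case by (simp add: continuous_on_add)
next
  case (Suc k)
  show ?case
    using Ck_on_SucD[OF Suc.prems(1)] Ck_on_SucD[OF Suc.prems(2)] Suc.IH assms(1)
    by (intro Ck_on_SucI[where f' = "\<lambda>x v. frechet_derivative f (at x) v + frechet_derivative g (at x) v"])
      (auto intro: has_derivative_add)
qed

lemma Ck_on_mult:
  fixes f g :: "'a::euclidean_space \<Rightarrow> real"
  assumes "open U" "Ck_on k U f" "Ck_on k U g"
  shows "Ck_on k U (\<lambda>x. f x * g x)"
  using assms(2,3)
proof (induction k arbitrary: f g)
  case 0
  then show ?case by (simp add: continuous_on_mult)
next
  case (Suc k)
  show ?case
    using Ck_on_SucD[OF Suc.prems(1)] Ck_on_SucD[OF Suc.prems(2)] Suc.IH assms(1)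
    by (intro Ck_on_SucI[where f' = "\<lambda>x v. f x * frechet_derivative g (at x) v
          + frechet_derivative f (at x) v * g x"])
      (auto intro: has_derivative_mult Ck_on_add)
qed

text \<open>The derivatives of \<open>exp (- 1 / x)\<close> are of the form \<open>P (1 / x) * exp (- 1 / x)\<close>
  with a polynomial \<open>P\<close>; hence the parameter.\<close>

definition flat :: "real poly \<Rightarrow> real \<Rightarrow> real" where
  "flat P x = (if x > 0 then poly P (1 / x) * exp (- (1 / x)) else 0)"

lemma poly_exp_tendsto_0: "((\<lambda>y. poly P y * exp (- y)) \<longlongrightarrow> (0::real)) at_top"
proof -
  have "((\<lambda>y. \<Sum>i\<le>degree P. coeff P i * (y ^ i * exp (- y))) \<longlongrightarrow> (\<Sum>i\<le>degree P. coeff P i * 0)) at_top"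
  proof (intro tendsto_intros)
    fix i
    show "((\<lambda>y. y ^ i * exp (- y)) \<longlongrightarrow> (0::real)) at_top"
      using tendsto_power_div_exp_0[of i] by (simp add: exp_minus divide_inverse)
  qed
  then show ?thesis
    by (simp add: poly_altdef sum_distrib_right mult.assoc)
qed

text \<open>For x > 0 put y = 1/x, so dy/dx = - y^2; differentiating P(y) exp(-y) gives y^2 (P -
  P')(y) exp(-y), which explains the new polynomial. At 0 the two one-sided difference quotients
  tend to 0.\<close>

lemma flat_has_derivative:
  "(flat P has_field_derivative flat ([:0, 0, 1:] * (P - pderiv P)) x) (at x)"
proof (cases "x = 0")
  case False
  show ?thesis
  proof (cases "x > 0")
    case True
    have "((\<lambda>x. poly P (1 / x) * exp (- (1 / x))) has_field_derivative
        flat ([:0, 0, 1:] * (P - pderiv P)) x) (at x)"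
      using True unfolding flat_def
      by (auto intro!: derivative_eq_intros DERIV_chain2[OF poly_DERIV] simp: field_simps power2_eq_square)
    then show ?thesis
      by (rule has_field_derivative_transform_within_open[where S = "{0<..}"])
        (use True in \<open>auto simp: flat_def\<close>)
  next
    case neg: False
    with False have "x < 0" by simp
    have "((\<lambda>x. 0) has_field_derivative flat ([:0, 0, 1:] * (P - pderiv P)) x) (at x)"
      using \<open>x < 0\<close> by (simp add: flat_def)
    then show ?thesis
      by (rule has_field_derivative_transform_within_open[where S = "{..<0}"])
        (use \<open>x < 0\<close> in \<open>auto simp: flat_def\<close>)
  qed
next
  case True
  have right: "((\<lambda>h. flat P h / h) \<longlongrightarrow> 0) (at_right 0)"
  proof -
    \<comment> \<open>Dividing by h multiplies by 1/h, so P is replaced by X * P, that is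
      \<open>pCons 0 P\<close>.\<close>
    have "((\<lambda>h. poly (pCons 0 P) (inverse h) * exp (- inverse h)) \<longlongrightarrow> (0::real)) (at_right 0)"
      by (rule filterlim_compose[OF poly_exp_tendsto_0 filterlim_inverse_at_top_right])
    moreover have "\<forall>\<^sub>F h in at_right 0. poly (pCons 0 P) (inverse h) * exp (- inverse h) = flat P h / h"
      by (rule eventually_mono[OF eventually_at_right_less[of 0]])
        (simp add: flat_def inverse_eq_divide)
    ultimately show ?thesis
      by (rule Lim_transform_eventually)
  qed
  have left: "((\<lambda>h. flat P h / h) \<longlongrightarrow> 0) (at_left 0)"
  proof (rule Lim_transform_eventually[OF tendsto_const])
    show "\<forall>\<^sub>F h in at_left 0. 0 = flat P h / h"
      using lt_ex by (auto simp: flat_def eventually_at_left_field)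
  qed
  from left right have "((\<lambda>h. flat P h / h) \<longlongrightarrow> 0) (at 0)"
    by (simp add: filterlim_at_split)
  then show ?thesis
    using True by (simp add: DERIV_def flat_def)
qed

text \<open>Differentiating changes the polynomial, so the induction on k has to run over all P at
  once.\<close>

lemma Ck_on_flat:
  assumes "open U" "Ck_on k U f"
  shows "Ck_on k U (\<lambda>x. flat P (f x))"
  using assms(2)
proof (induction k arbitrary: f P)
  case 0
  have "continuous_on UNIV (flat P)"
    by (intro continuous_at_imp_continuous_on ballI DERIV_isCont[OF flat_has_derivative])
  then show ?case
    using continuous_on_compose2[of UNIV "flat P" U f] 0 by simp
next
  case (Suc k)
  let ?Q = "[:0, 0, 1:] * (P - pderiv P)"
  show ?case
  proof (rule Ck_on_SucI[OF assms(1)])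
    fix x assume "x \<in> U"
    show "((\<lambda>x. flat P (f x)) has_derivative (\<lambda>v. flat ?Q (f x) * frechet_derivative f (at x) v)) (at x)"
      using has_derivative_compose[OF Ck_on_SucD(1)[OF Suc.prems \<open>x \<in> U\<close>]
          flat_has_derivative[unfolded has_field_derivative_def]] .
  next
    show "Ck_on k U (\<lambda>x. flat ?Q (f x) * frechet_derivative f (at x) v)" for v
      by (intro Ck_on_mult assms Suc.IH Ck_on_SucD[OF Suc.prems])
  qed
qed

section \<open>Functions on arbitrary subsets that locally extend to smooth functions\<close>

text \<open>The local extensions of the two functions live on different neighbourhoods and are
  combined on the intersection. Unary operations are covered by letting \<open>H\<close> ignore its
  second argument.\<close>

lemma smooth_on_combine:
  fixes S :: "'a::euclidean_space set"
  assumes "\<And>(U :: 'a set) g h k. open U \<Longrightarrow> (\<And>k. Ck_on k U g) \<Longrightarrow> (\<And>k. Ck_on k U h) \<Longrightarrow> Ck_on k U (\<lambda>x. H (g x) (h x))"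
    and "smooth_on S f" "smooth_on S f'"
  shows "smooth_on S (\<lambda>x. H (f x) (f' x))"
  unfolding smooth_on_def
proof
  fix x assume "x \<in> S"
  obtain U g where g: "open U" "x \<in> U" "\<And>k. Ck_on k U g" "\<And>y. y \<in> S \<inter> U \<Longrightarrow> g y = f y"
    using assms(2) \<open>x \<in> S\<close> unfolding smooth_on_def by meson
  obtain V h where h: "open V" "x \<in> V" "\<And>k. Ck_on k V h" "\<And>y. y \<in> S \<inter> V \<Longrightarrow> h y = f' y"
    using assms(3) \<open>x \<in> S\<close> unfolding smooth_on_def by meson
  have "Ck_on k (U \<inter> V) (\<lambda>x. H (g x) (h x))" for k
    by (intro assms(1)) (use g h in \<open>auto intro: Ck_on_subset\<close>)
  then show "\<exists>U g. open U \<and> x \<in> U \<and> (\<forall>k. Ck_on k U g) \<and> (\<forall>y\<in>S \<inter> U. g y = H (f y) (f' y))"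
    using g h by (intro exI[of _ "U \<inter> V"] exI[of _ "\<lambda>x. H (g x) (h x)"]) auto
qed

lemma smooth_on_const: "smooth_on S (\<lambda>x. c)"
  unfolding smooth_on_def
  by (intro ballI exI[of _ UNIV] exI[of _ "\<lambda>_. c"]) (simp add: Ck_on_const)

lemma smooth_on_add: "smooth_on S f \<Longrightarrow> smooth_on S g \<Longrightarrow> smooth_on S (\<lambda>x. f x + g x)"
  by (rule smooth_on_combine) (auto intro: Ck_on_add)

lemma smooth_on_mult:
  fixes f g :: "'a::euclidean_space \<Rightarrow> real"
  shows "smooth_on S f \<Longrightarrow> smooth_on S g \<Longrightarrow> smooth_on S (\<lambda>x. f x * g x)"
  by (rule smooth_on_combine) (auto intro: Ck_on_mult)

lemma smooth_on_sum:
  "(\<And>i. i \<in> I \<Longrightarrow> smooth_on S (f i)) \<Longrightarrow> smooth_on S (\<lambda>x. \<Sum>i\<in>I. f i x)"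
  by (induction I rule: infinite_finite_induct) (auto intro: smooth_on_add smooth_on_const)

lemma smooth_on_bounded_linear:
  "bounded_linear A \<Longrightarrow> smooth_on S f \<Longrightarrow> smooth_on S (\<lambda>x. A (f x))"
  by (rule smooth_on_combine[where H = "\<lambda>a b. A a" and f' = "\<lambda>_. 0"])
    (auto intro: Ck_on_bounded_linear smooth_on_const)

lemma smooth_on_flat: "smooth_on S f \<Longrightarrow> smooth_on S (\<lambda>x. flat P (f x))"
  by (rule smooth_on_combine[where H = "\<lambda>a b. flat P a" and f' = "\<lambda>_. 0"])
    (auto intro: Ck_on_flat smooth_on_const)

lemma smooth_on_cong:
  assumes "smooth_on S f" "\<And>x. x \<in> S \<Longrightarrow> f x = g x"
  shows "smooth_on S g"
proof -
  have "(\<forall>y\<in>S \<inter> U. h y = f y) = (\<forall>y\<in>S \<inter> U. h y = g y)" for U h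
    by (intro ball_cong) (simp_all add: assms(2))
  with assms(1) show ?thesis
    unfolding smooth_on_def by simp
qed

section \<open>Bump functions and extension of sections\<close>

lemma smooth_on_subset:
  assumes "smooth_on S f" "T \<subseteq> S"
  shows "smooth_on T f"
  unfolding smooth_on_def
proof
  fix x assume "x \<in> T"
  with assms(2) have "x \<in> S" ..
  with assms(1) obtain U g where "open U" "x \<in> U" "\<forall>k. Ck_on k U g" "\<forall>y\<in>S \<inter> U. g y = f y"
    unfolding smooth_on_def by meson
  with assms(2) show "\<exists>U g. open U \<and> x \<in> U \<and> (\<forall>k. Ck_on k U g) \<and> (\<forall>y\<in>T \<inter> U. g y = f y)"
    by (intro exI[of _ U] exI[of _ g]) auto
qed

lemma smooth_funD:
  "smooth_fun X U f \<Longrightarrow> (W, \<phi>) \<in> atlas X \<Longrightarrow> smooth_on (\<phi> ` (U \<inter> W)) (\<lambda>x. f (inv_into W \<phi> x))"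
  by (auto simp: smooth_fun_def o_def)

lemma smooth_funI:
  "(\<And>W \<phi>. (W, \<phi>) \<in> atlas X \<Longrightarrow> smooth_on (\<phi> ` (U \<inter> W)) (\<lambda>x. f (inv_into W \<phi> x))) \<Longrightarrow> smooth_fun X U f"
  by (auto simp: smooth_fun_def o_def)

section \<open>Smooth functions on a manifold and cut-off functions\<close>

context smooth_manifold
begin

lemma chart_inverse: "(W, \<phi>) \<in> atlas X \<Longrightarrow> q \<in> W \<Longrightarrow> inv_into W \<phi> (\<phi> q) = q"
  by (rule homeomorphism_apply1[OF chart_homeomorphism])

lemma smooth_fun_const: "smooth_fun X U (\<lambda>q. c)"
  by (rule smooth_funI, rule smooth_on_const)

lemma smooth_fun_add:
  "smooth_fun X U f \<Longrightarrow> smooth_fun X U g \<Longrightarrow> smooth_fun X U (\<lambda>q. f q + g q)"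
  by (rule smooth_funI, rule smooth_on_add; erule (1) smooth_funD)

lemma smooth_fun_mult:
  fixes f g :: "'m \<Rightarrow> real"
  shows "smooth_fun X U f \<Longrightarrow> smooth_fun X U g \<Longrightarrow> smooth_fun X U (\<lambda>q. f q * g q)"
  by (rule smooth_funI, rule smooth_on_mult; erule (1) smooth_funD)

lemma smooth_fun_sum:
  "(\<And>i. i \<in> I \<Longrightarrow> smooth_fun X U (f i)) \<Longrightarrow> smooth_fun X U (\<lambda>q. \<Sum>i\<in>I. f i q)"
  by (induction I rule: infinite_finite_induct) (simp_all add: smooth_fun_add smooth_fun_const)

lemma smooth_fun_subset: "smooth_fun X U f \<Longrightarrow> V \<subseteq> U \<Longrightarrow> smooth_fun X V f"
  by (rule smooth_funI, rule smooth_on_subset, erule (1) smooth_funD, blast)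

lemma smooth_fun_cong:
  assumes "smooth_fun X U f" "\<And>q. q \<in> U \<Longrightarrow> f q = g q"
  shows "smooth_fun X U g"
proof (rule smooth_funI)
  fix W \<phi> assume W: "(W, \<phi>) \<in> atlas X"
  from smooth_funD[OF assms(1) W] show "smooth_on (\<phi> ` (U \<inter> W)) (\<lambda>x. g (inv_into W \<phi> x))"
    by (rule smooth_on_cong) (auto simp: chart_inverse[OF W] assms(2))
qed

text \<open>\<open>smooth_on\<close> asks for open sets of the ambient Euclidean space, whereas a
  chart image is open only in \<open>model X\<close>. A chart is open onto its image, which yields
  Q, and it is injective, so Q tells the points of N from the other points of W.\<close>

lemma chart_open_image:
  assumes W: "(W, \<phi>) \<in> atlas X" and "open N"
  obtains Q where "open Q" "\<forall>q\<in>W. \<phi> q \<in> Q \<longleftrightarrow> q \<in> N"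
proof -
  have "openin (top_of_set W) (W \<inter> N)"
    using assms(2) by (auto simp: openin_open)
  then have "openin (top_of_set (\<phi> ` W)) (\<phi> ` (W \<inter> N))"
    by (rule homeomorphism_imp_open_map[OF chart_homeomorphism[OF W]])
  then obtain Q where Q: "open Q" "\<phi> ` (W \<inter> N) = \<phi> ` W \<inter> Q"
    by (auto simp: openin_open)
  have inj: "inj_on \<phi> W"
    by (rule inj_on_inverseI[of W "inv_into W \<phi>"]) (rule chart_inverse[OF W])
  have "\<phi> q \<in> Q \<longleftrightarrow> q \<in> N" if "q \<in> W" for q
  proof -
    have "\<phi> q \<in> Q \<longleftrightarrow> \<phi> q \<in> \<phi> ` (W \<inter> N)"
      using Q(2) that by simp
    also have "\<dots> \<longleftrightarrow> q \<in> W \<inter> N"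
      by (rule inj_on_image_mem_iff[OF inj that]) simp
    finally show ?thesis
      using that by simp
  qed
  with Q(1) show thesis using that by blast
qed

text \<open>N and the complement of K are open and cover the manifold: on the former f is smooth by
  assumption, on the latter the zero function extends it.\<close>

lemma smooth_fun_extend_zero:
  assumes "open N" "closed K" "K \<subseteq> N" "smooth_fun X (U \<inter> N) f" "\<And>q. q \<in> U \<Longrightarrow> q \<notin> K \<Longrightarrow> f q = 0"
  shows "smooth_fun X U f"
proof (rule smooth_funI)
  fix W \<phi> assume W: "(W, \<phi>) \<in> atlas X"
  show "smooth_on (\<phi> ` (U \<inter> W)) (\<lambda>x. f (inv_into W \<phi> x))"
    unfolding smooth_on_def
  proof clarify
    fix q assume q: "q \<in> U" "q \<in> W"
    show "\<exists>Q g. open Q \<and> \<phi> q \<in> Q \<and> (\<forall>k. Ck_on k Q g) \<and>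
        (\<forall>y\<in>\<phi> ` (U \<inter> W) \<inter> Q. g y = f (inv_into W \<phi> y))"
    proof (cases "q \<in> N")
      case True
      obtain Q where Q: "open Q" "\<forall>q\<in>W. \<phi> q \<in> Q \<longleftrightarrow> q \<in> N"
        using chart_open_image[OF W assms(1)] .
      have "\<phi> q \<in> \<phi> ` (U \<inter> N \<inter> W)"
        using True q by simp
      with smooth_funD[OF assms(4) W]
      obtain V g where V: "open V" "\<phi> q \<in> V" "\<forall>k. Ck_on k V g"
        "\<forall>y\<in>\<phi> ` (U \<inter> N \<inter> W) \<inter> V. g y = f (inv_into W \<phi> y)"
        unfolding smooth_on_def by meson
      have "\<forall>y\<in>\<phi> ` (U \<inter> W) \<inter> (V \<inter> Q). g y = f (inv_into W \<phi> y)"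
        using V(4) Q(2) by auto
      moreover have "\<phi> q \<in> V \<inter> Q"
        using True q Q(2) V(2) by simp
      ultimately show ?thesis
        using open_Int[OF V(1) Q(1)] Ck_on_subset[OF spec[OF V(3)] Int_lower1[of V Q]] by meson
    next
      case False
      obtain Q where Q: "open Q" "\<forall>q\<in>W. \<phi> q \<in> Q \<longleftrightarrow> q \<in> - K"
        using chart_open_image[OF W open_Compl[OF assms(2)]] .
      have "\<phi> q \<in> Q"
        using False assms(3) q Q(2) by auto
      then show ?thesis
        using Q assms(5) chart_inverse[OF W]
        by (intro exI[of _ Q] exI[of _ "\<lambda>_. 0"]) (auto simp: Ck_on_const)
    qed
  qed
qed

text \<open>In a chart around p take exp(-1/(r^2 - d)) with d the squared distance to p, continued
  by 0. Its support lies in K, the preimage of a closed ball; K is compact, hence closed because the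
  manifold is Hausdorff, so extension by zero applies.\<close>

lemma ex_bump_function:
  assumes "open N" "p \<in> N"
  obtains h :: "'m \<Rightarrow> real" and K where "closed K" "K \<subseteq> N" "smooth_fun X UNIV h" "h p = 1"
    "\<And>q. q \<notin> K \<Longrightarrow> h q = 0"
proof -
  have "p \<in> (\<Union>(W, \<phi>)\<in>atlas X. W)"
    unfolding charts_cover ..
  then obtain V \<phi> where V: "(V, \<phi>) \<in> atlas X" "p \<in> V"
    by auto
  have "openin (top_of_set V) (N \<inter> V)"
    using assms(1) by (auto simp: openin_open)
  from homeomorphism_imp_open_map[OF chart_homeomorphism[OF V(1)] this]
  have "openin (top_of_set (model X)) (\<phi> ` (N \<inter> V))"
    using chart_image[OF V(1)] by (rule openin_trans)
  moreover have "\<phi> p \<in> \<phi> ` (N \<inter> V)"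
    using assms(2) V(2) by simp
  \<comment> \<open>Only the trace of the ball on the model subspace can be fitted into the chart
    image, which need not be open in the ambient space.\<close>
  ultimately have "\<exists>r>0. cball (\<phi> p) r \<inter> model X \<subseteq> \<phi> ` (N \<inter> V)"
    by (simp only: openin_contains_cball)
  then obtain r where r: "r > 0" "cball (\<phi> p) r \<inter> model X \<subseteq> \<phi> ` (N \<inter> V)"
    by blast
  have model: "\<phi> q \<in> model X" if "q \<in> V" for q
    using openin_imp_subset[OF chart_image[OF V(1)]] that by auto
  define C where "C = cball (\<phi> p) r \<inter> model X"
  define K where "K = inv_into V \<phi> ` C"
  have "compact C"
    unfolding C_def by (intro compact_Int_closed compact_cball closed_subspace model_subspace)
  moreover have "C \<subseteq> \<phi> ` V"
    using r(2) unfolding C_def by auto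
  ultimately have "compact K"
    unfolding K_def
    by (intro compact_continuous_image continuous_on_subset[OF homeomorphism_cont2[OF chart_homeomorphism[OF V(1)]]])
  then have "closed K" by (rule compact_imp_closed)
  have K: "K \<subseteq> N \<inter> V"
  proof
    fix q assume "q \<in> K"
    then obtain y where y: "y \<in> C" "q = inv_into V \<phi> y"
      unfolding K_def by (rule imageE)
    from y(1) have "y \<in> \<phi> ` (N \<inter> V)"
      using r(2) unfolding C_def by (rule set_mp[rotated])
    then obtain q' where "y = \<phi> q'" "q' \<in> N \<inter> V"
      by (rule imageE)
    with y(2) show "q \<in> N \<inter> V"
      by (simp add: chart_inverse[OF V(1)])
  qed
  \<comment> \<open>The squared distance, written out in coordinates so that the closure of smooth
    functions under sums and products applies directly.\<close>
  define d where "d q = (\<Sum>b\<in>Basis. (\<phi> q \<bullet> b + - (\<phi> p \<bullet> b)) * (\<phi> q \<bullet> b + - (\<phi> p \<bullet> b)))" for q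
  have d: "d q = (dist (\<phi> q) (\<phi> p))\<^sup>2" for q
  proof -
    have "d q = (\<Sum>b\<in>Basis. (\<phi> q - \<phi> p) \<bullet> b * ((\<phi> q - \<phi> p) \<bullet> b))"
      unfolding d_def by (rule sum.cong) (simp_all add: inner_diff_left)
    also have "\<dots> = (\<phi> q - \<phi> p) \<bullet> (\<phi> q - \<phi> p)"
      by (rule euclidean_inner[symmetric])
    finally show ?thesis
      by (simp only: dist_norm power2_norm_eq_inner)
  qed
  \<comment> \<open>The value at p, where d = 0; dividing by it gives h p = 1.\<close>
  define c where "c = flat 1 (r\<^sup>2)"
  have "c > 0" using r(1) by (simp add: c_def flat_def)
  define h where "h q = (if q \<in> V then flat 1 (r\<^sup>2 + (- 1) * d q) * (1 / c) else 0)" for q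
  have outside: "h q = 0" if "q \<notin> K" for q
  proof (cases "q \<in> V")
    case True
    have "\<phi> q \<notin> C"
      using that chart_inverse[OF V(1) True] imageI[of "\<phi> q" C "inv_into V \<phi>"] by (auto simp: K_def)
    then have "dist (\<phi> q) (\<phi> p) > r"
      using model[OF True] by (simp add: C_def dist_commute)
    then have "r\<^sup>2 \<le> d q"
      using r(1) unfolding d by (simp add: power_mono)
    then show ?thesis by (simp add: h_def flat_def)
  qed (simp add: h_def)
  have "smooth_fun X V h"
  proof (rule smooth_funI)
    fix W \<psi> assume W: "(W, \<psi>) \<in> atlas X"
    have F: "smooth_on (\<psi> ` (V \<inter> W)) (\<lambda>x. \<phi> (inv_into W \<psi> x))"
      using chart_transition[OF W V(1)] by (simp add: o_def Int_commute)
    have "smooth_on (\<psi> ` (V \<inter> W)) (\<lambda>x. flat 1 (r\<^sup>2 + (- 1) * d (inv_into W \<psi> x)) * (1 / c))"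
      unfolding d_def
      by (intro smooth_on_mult smooth_on_flat smooth_on_add smooth_on_const smooth_on_sum
          smooth_on_bounded_linear[OF bounded_linear_inner_left F])
    then show "smooth_on (\<psi> ` (V \<inter> W)) (\<lambda>x. h (inv_into W \<psi> x))"
      by (rule smooth_on_cong) (auto simp: h_def chart_inverse[OF W] simp del: mult_minus1)
  qed
  then have "smooth_fun X UNIV h"
    using K outside by - (rule smooth_fun_extend_zero[OF chart_open[OF V(1)] \<open>closed K\<close>], simp_all)
  moreover have "h p = 1"
    using V(2) \<open>c > 0\<close> by (simp add: h_def d c_def[symmetric])
  ultimately show thesis
    using that[OF \<open>closed K\<close> _ _ _ outside] K by simp
qed

end

section \<open>Sections of a vector bundle\<close>

context vector_bundle
begin

lemma ex_frame: obtains W k b where "(W, k, b) \<in> frames X" "p \<in> W"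
proof -
  have "p \<in> (\<Union>(W, k, b)\<in>frames X. W)"
    unfolding frames_cover ..
  then show thesis using that by auto
qed

lemma fibre_subspace: "subspace (fibre X p)"
proof -
  obtain W k b where "(W, k, b) \<in> frames X" "p \<in> W"
    by (rule ex_frame)
  from frame_basis[OF this] show ?thesis
    using subspace_span[of "(\<lambda>i. b i p) ` {..<k}"] by simp
qed

lemma frame_expansion:
  assumes "(W, k, b) \<in> frames X" "p \<in> W" "u \<in> fibre X p"
  obtains c where "u = (\<Sum>i<k. c i *\<^sub>R b i p)"
proof -
  note B = frame_basis[OF assms(1,2)]
  have "u \<in> span ((\<lambda>i. b i p) ` {..<k})"
    using B assms(3) by blast
  then obtain c where "u = (\<Sum>v\<in>(\<lambda>i. b i p) ` {..<k}. c v *\<^sub>R v)"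
    by (auto simp: span_finite)
  also have "\<dots> = (\<Sum>i<k. c (b i p) *\<^sub>R b i p)"
    using B by (subst sum.reindex) auto
  finally show thesis using that[of "\<lambda>i. c (b i p)"] by blast
qed

lemma frame_in_fibre:
  assumes "(W, k, b) \<in> frames X" "p \<in> W" "i < k"
  shows "b i p \<in> fibre X p"
  using frame_basis[OF assms(1,2)] assms(3) span_base[of "b i p" "(\<lambda>i. b i p) ` {..<k}"] by auto

lemma sections_in_fibre: "s \<in> sections X U \<Longrightarrow> p \<in> U \<Longrightarrow> s p \<in> fibre X p"
  by (simp add: sections_def)

lemma sections_coefficients:
  assumes "s \<in> sections X U" "(W, k, b) \<in> frames X"
  shows "\<exists>c. (\<forall>i<k. smooth_fun X (U \<inter> W) (c i :: 'm \<Rightarrow> real)) \<and>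
      (\<forall>p\<in>U \<inter> W. s p = (\<Sum>i<k. c i p *\<^sub>R b i p))"
  using assms unfolding sections_def by blast

lemma sectionsI:
  assumes "\<And>p. p \<in> U \<Longrightarrow> s p \<in> fibre X p"
    and "\<And>W k b. (W, k, b) \<in> frames X \<Longrightarrow>
      \<exists>c. (\<forall>i<k. smooth_fun X (U \<inter> W) (c i :: 'm \<Rightarrow> real)) \<and>
        (\<forall>p\<in>U \<inter> W. s p = (\<Sum>i<k. c i p *\<^sub>R b i p))"
  shows "s \<in> sections X U"
  using assms unfolding sections_def by blast

lemma sections_mult:
  fixes f :: "'m \<Rightarrow> real"
  assumes "smooth_fun X U f" "s \<in> sections X U"
  shows "(\<lambda>p. f p *\<^sub>R s p) \<in> sections X U"
proof (rule sectionsI)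
  show "f p *\<^sub>R s p \<in> fibre X p" if "p \<in> U" for p
    using fibre_subspace sections_in_fibre[OF assms(2) that] by (rule subspace_scale)
next
  fix W k b assume F: "(W, k, b) \<in> frames X"
  obtain c where c: "\<forall>i<k. smooth_fun X (U \<inter> W) (c i :: 'm \<Rightarrow> real)"
    "\<forall>p\<in>U \<inter> W. s p = (\<Sum>i<k. c i p *\<^sub>R b i p)"
    using sections_coefficients[OF assms(2) F] by blast
  have "smooth_fun X (U \<inter> W) f"
    by (rule smooth_fun_subset[OF assms(1)]) simp
  with c show "\<exists>c. (\<forall>i<k. smooth_fun X (U \<inter> W) (c i :: 'm \<Rightarrow> real)) \<and>
      (\<forall>p\<in>U \<inter> W. f p *\<^sub>R s p = (\<Sum>i<k. c i p *\<^sub>R b i p))"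
    by (intro exI[of _ "\<lambda>i p. f p * c i p"]) (simp add: smooth_fun_mult scaleR_sum_right)
qed

lemma sections_scale: "s \<in> sections X U \<Longrightarrow> (\<lambda>p. r *\<^sub>R s p) \<in> sections X U"
  by (rule sections_mult[OF smooth_fun_const])

lemma sections_uminus: "s \<in> sections X U \<Longrightarrow> (\<lambda>p. - s p) \<in> sections X U"
  using sections_scale[of s U "- 1"] by simp

text \<open>Take constant coefficients in a frame around p, multiply by a bump function supported in
  its domain and continue by zero. The work lies in testing smoothness against every other
  frame.\<close>

lemma ex_global_section:
  assumes "u \<in> fibre X p"
  obtains s where "s \<in> global_sections X" "s p = u"
proof -
  obtain W k b where F: "(W, k, b) \<in> frames X" "p \<in> W"
    by (rule ex_frame)
  obtain a where a: "u = (\<Sum>i<k. a i *\<^sub>R b i p)"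
    using frame_expansion[OF F assms] .
  obtain K and h :: "'m \<Rightarrow> real" where h: "closed K" "K \<subseteq> W" "smooth_fun X UNIV h" "h p = 1"
    "\<And>q. q \<notin> K \<Longrightarrow> h q = 0"
    by (rule ex_bump_function[OF frame_open[OF F(1)] F(2)]) blast
  define s where "s q = (if q \<in> W then \<Sum>i<k. (h q * a i) *\<^sub>R b i q else 0)" for q
  have "s \<in> global_sections X"
  proof (rule sectionsI)
    show "s q \<in> fibre X q" for q
      using frame_in_fibre[OF F(1)] unfolding s_def
      by (auto intro!: subspace_sum subspace_scale fibre_subspace subspace_0)
  next
    fix W' k' b' assume F': "(W', k', b') \<in> frames X"
    have "\<exists>c. (\<forall>j<k'. smooth_fun X (W \<inter> W') (c j :: 'm \<Rightarrow> real)) \<and>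
        (\<forall>q\<in>W \<inter> W'. b i q = (\<Sum>j<k'. c j q *\<^sub>R b' j q))" if "i < k" for i
      using sections_coefficients[OF frame_transition[OF F(1) that] F'] .
    then obtain c where "\<And>i. i < k \<Longrightarrow> (\<forall>j<k'. smooth_fun X (W \<inter> W') (c i j :: 'm \<Rightarrow> real)) \<and>
        (\<forall>q\<in>W \<inter> W'. b i q = (\<Sum>j<k'. c i j q *\<^sub>R b' j q))"
      by metis
    then have c: "\<And>i j. i < k \<Longrightarrow> j < k' \<Longrightarrow> smooth_fun X (W \<inter> W') (c i j :: 'm \<Rightarrow> real)"
      "\<And>i q. i < k \<Longrightarrow> q \<in> W \<inter> W' \<Longrightarrow> b i q = (\<Sum>j<k'. c i j q *\<^sub>R b' j q)"
      by blast+
    \<comment> \<open>The coefficients of s in the frame b', obtained from the transition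
      coefficients c over the overlap; the factor h makes the continuation by 0 smooth.\<close>
    define C where "C j q = (if q \<in> W then \<Sum>i<k. h q * a i * c i j q else 0)" for j q
    have "smooth_fun X W' (C j)" if "j < k'" for j
    proof (rule smooth_fun_extend_zero[OF frame_open[OF F(1)] h(1,2)])
      have "smooth_fun X (W' \<inter> W) (\<lambda>q. \<Sum>i<k. h q * a i * c i j q)"
        using c(1)[OF _ that] smooth_fun_subset[OF h(3), of "W' \<inter> W"]
        by (intro smooth_fun_sum smooth_fun_mult smooth_fun_const) (simp_all add: Int_commute)
      then show "smooth_fun X (W' \<inter> W) (C j)"
        by (rule smooth_fun_cong) (simp add: C_def)
      show "C j q = 0" if "q \<notin> K" for q
        using h(5)[OF that] by (simp add: C_def)
    qed
    moreover have "s q = (\<Sum>j<k'. C j q *\<^sub>R b' j q)" if "q \<in> W'" for q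
    proof (cases "q \<in> W")
      case True
      then have "s q = (\<Sum>i<k. (h q * a i) *\<^sub>R (\<Sum>j<k'. c i j q *\<^sub>R b' j q))"
        using that c(2) by (simp add: s_def)
      also have "\<dots> = (\<Sum>j<k'. \<Sum>i<k. (h q * a i * c i j q) *\<^sub>R b' j q)"
        unfolding scaleR_sum_right scaleR_scaleR by (rule sum.swap)
      also have "\<dots> = (\<Sum>j<k'. C j q *\<^sub>R b' j q)"
        using True by (simp add: C_def scaleR_sum_left)
      finally show ?thesis .
    qed (simp add: s_def C_def)
    ultimately show "\<exists>c. (\<forall>i<k'. smooth_fun X (UNIV \<inter> W') (c i :: 'm \<Rightarrow> real)) \<and>
        (\<forall>q\<in>UNIV \<inter> W'. s q = (\<Sum>i<k'. c i q *\<^sub>R b' i q))"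
      by auto
  qed
  moreover have "s p = u"
    using F(2) h(4) a by (simp add: s_def)
  ultimately show thesis by (rule that)
qed

end

section \<open>Linear maps on the fibres\<close>

text \<open>The maps in question are functions on the whole type but are controlled on a fibre only,
  so \<open>linear\<close> would claim too much.\<close>

definition linear_on :: "'a::real_vector set \<Rightarrow> ('a \<Rightarrow> 'b::real_vector) \<Rightarrow> bool" where
  "linear_on F f \<longleftrightarrow>
     (\<forall>u\<in>F. \<forall>v\<in>F. f (u + v) = f u + f v) \<and> (\<forall>u\<in>F. \<forall>r. f (r *\<^sub>R u) = r *\<^sub>R f u)"

lemma linear_onI:
  "(\<And>u v. u \<in> F \<Longrightarrow> v \<in> F \<Longrightarrow> f (u + v) = f u + f v) \<Longrightarrow>
    (\<And>u r. u \<in> F \<Longrightarrow> f (r *\<^sub>R u) = r *\<^sub>R f u) \<Longrightarrow> linear_on F f"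
  by (simp add: linear_on_def)

lemma linear_on_add: "linear_on F f \<Longrightarrow> u \<in> F \<Longrightarrow> v \<in> F \<Longrightarrow> f (u + v) = f u + f v"
  by (simp add: linear_on_def)

lemma linear_on_scale: "linear_on F f \<Longrightarrow> u \<in> F \<Longrightarrow> f (r *\<^sub>R u) = r *\<^sub>R f u"
  by (simp add: linear_on_def)

lemma linear_on_uminus: "linear_on F f \<Longrightarrow> u \<in> F \<Longrightarrow> f (- u) = - f u"
  using linear_on_scale[of F f u "- 1"] by simp

lemma linear_on_sum:
  assumes "linear_on F f" "subspace F" "\<And>i. i \<in> I \<Longrightarrow> s i \<in> F"
  shows "f (\<Sum>i\<in>I. c i *\<^sub>R s i) = (\<Sum>i\<in>I. c i *\<^sub>R f (s i))"
proof -
  have "f 0 = 0"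
    using linear_on_scale[OF assms(1) subspace_0[OF assms(2)], of 0] by simp
  then show ?thesis
    using assms(3)
  proof (induction I rule: infinite_finite_induct)
    case (insert i I)
    then have "c i *\<^sub>R s i \<in> F" "(\<Sum>i\<in>I. c i *\<^sub>R s i) \<in> F"
      by (auto intro!: subspace_sum subspace_scale assms(2))
    with insert show ?case
      by (simp add: linear_on_add[OF assms(1)] linear_on_scale[OF assms(1)])
  qed auto
qed

text \<open>Replaces a dimension count in the proof that a nondegenerate pairing represents all
  functionals. Induction on I: either \<open>l j\<close> vanishes on the common kernel of the others
  and gets coefficient 0, or some v0 in that kernel has \<open>l j v0\<close> nonzero and a multiple
  of \<open>l j\<close> is subtracted from g.\<close>

lemma linear_functional_combination:
  fixes l :: "'i \<Rightarrow> 'a::real_vector \<Rightarrow> real"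
  assumes "subspace F" "finite I" "\<And>i. i \<in> I \<Longrightarrow> linear_on F (l i)" "linear_on F g"
    and "\<And>v. v \<in> F \<Longrightarrow> (\<And>i. i \<in> I \<Longrightarrow> l i v = 0) \<Longrightarrow> g v = 0"
  shows "\<exists>c. \<forall>v\<in>F. g v = (\<Sum>i\<in>I. c i * l i v)"
  using assms(2-5)
proof (induction I arbitrary: g rule: finite_induct)
  case empty
  then show ?case by simp
next
  case (insert j I)
  show ?case
  proof (cases "\<forall>v\<in>F. (\<forall>i\<in>I. l i v = 0) \<longrightarrow> l j v = 0")
    case True
    have "\<exists>c. \<forall>v\<in>F. g v = (\<Sum>i\<in>I. c i * l i v)"
      using insert.prems True by (intro insert.IH) auto
    then obtain c where "\<forall>v\<in>F. g v = (\<Sum>i\<in>I. c i * l i v)" ..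
    then show ?thesis
      using insert.hyps by (intro exI[of _ "c(j := 0)"]) (auto intro!: sum.cong)
  next
    case False
    then obtain v0 where v0: "v0 \<in> F" "\<forall>i\<in>I. l i v0 = 0" "l j v0 \<noteq> 0"
      by blast
    \<comment> \<open>The multiple for which g - r * l j vanishes at v0.\<close>
    define r where "r = g v0 / l j v0"
    note lj = insert.prems(1)[OF insertI1]
    note [simp] = linear_on_add[OF lj] linear_on_scale[OF lj]
      linear_on_add[OF insert.prems(2)] linear_on_scale[OF insert.prems(2)]
    have lin: "linear_on F (\<lambda>v. g v - r * l j v)"
      by (rule linear_onI) (simp_all add: algebra_simps)
    have "g v - r * l j v = 0" if v: "v \<in> F" "\<And>i. i \<in> I \<Longrightarrow> l i v = 0" for v
    proof -
      \<comment> \<open>Chosen so that v + s v0 is killed by \<open>l j\<close> as well, hence by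
        all functionals of \<open>insert j I\<close>, and the assumption on g applies.\<close>
      define s where "s = - (l j v / l j v0)"
      have sv0: "s *\<^sub>R v0 \<in> F"
        using v0(1) assms(1) by (simp add: subspace_scale)
      have "g (v + s *\<^sub>R v0) = 0"
      proof (rule insert.prems(3))
        show "v + s *\<^sub>R v0 \<in> F"
          using v(1) sv0 assms(1) by (simp add: subspace_add)
        fix i assume i: "i \<in> insert j I"
        show "l i (v + s *\<^sub>R v0) = 0"
        proof (cases "i = j")
          case True
          then have "l i (v + s *\<^sub>R v0) = l j v + s * l j v0"
            using v(1) sv0 v0(1) by simp
          then show ?thesis
            using v0(3) by (simp add: s_def)
        next
          case False
          with i have "i \<in> I" by simp
          moreover have "linear_on F (l i)"
            using insert.prems(1) i .
          ultimately show ?thesis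
            using linear_on_add[of F "l i" v "s *\<^sub>R v0"] linear_on_scale[of F "l i" v0 s] v v0 sv0
            by simp
        qed
      qed
      then have "g v + s * g v0 = 0"
        using v(1) v0(1) sv0 by simp
      then show ?thesis
        using v0(3) by (simp add: s_def r_def)
    qed
    then have "\<exists>c. \<forall>v\<in>F. g v - r * l j v = (\<Sum>i\<in>I. c i * l i v)"
      using insert.prems(1) lin by (intro insert.IH) auto
    then obtain c where c: "\<forall>v\<in>F. g v - r * l j v = (\<Sum>i\<in>I. c i * l i v)" ..
    have "g v = (\<Sum>i\<in>insert j I. (c(j := r)) i * l i v)" if "v \<in> F" for v
    proof -
      have "(\<Sum>i\<in>I. (c(j := r)) i * l i v) = (\<Sum>i\<in>I. c i * l i v)"
        using insert.hyps by (intro sum.cong) auto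
      then show ?thesis
        using c that insert.hyps by (simp add: algebra_simps)
    qed
    then show ?thesis by blast
  qed
qed

section \<open>The time derivative\<close>

context vector_bundle
begin

text \<open>Near (t, p) the chart expression is the restriction of a function g that is smooth on an
  open set. Restricting g to the line of constant p gives the derivative, one-sided at 0 and
  1.\<close>

lemma smooth_fun_path_has_derivative:
  fixes f :: "real \<Rightarrow> 'm \<Rightarrow> real"
  assumes "smooth_fun_path X U f" "p \<in> U" "t \<in> {0..1}"
  shows "\<exists>D. ((\<lambda>s. f s p) has_real_derivative D) (at t within {0..1})"
proof -
  have "p \<in> (\<Union>(W, \<phi>)\<in>atlas X. W)"
    unfolding charts_cover ..
  then obtain W \<phi> where W: "(W, \<phi>) \<in> atlas X" "p \<in> W"
    by auto
  let ?S = "{0..1} \<times> \<phi> ` (U \<inter> W)"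
  have "smooth_on ?S (\<lambda>(t, x). f t (inv_into W \<phi> x))"
    using assms(1) W(1) unfolding smooth_fun_path_def by blast
  moreover have "(t, \<phi> p) \<in> ?S"
    using assms W by simp
  ultimately obtain V g where V: "open V" "(t, \<phi> p) \<in> V" "\<forall>k. Ck_on k V g"
    "\<forall>y\<in>?S \<inter> V. g y = (\<lambda>(t, x). f t (inv_into W \<phi> x)) y"
    unfolding smooth_on_def by meson
  have "Ck_on (Suc 0) V g"
    using V(3) ..
  then have "g differentiable at (t, \<phi> p)"
    using V(2) by simp
  then have "(\<lambda>s. g (s, \<phi> p)) differentiable at t within {0..1}"
    by (intro differentiable_chain_within[of "\<lambda>s. (s, \<phi> p)" t _ g, unfolded o_def])
      (auto intro: differentiable_at_withinI differentiable_Pair)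
  then obtain g' where g': "((\<lambda>s. g (s, \<phi> p)) has_derivative g') (at t within {0..1})"
    unfolding differentiable_def ..
  have eq: "g (s, \<phi> p) = f s p" if "s \<in> {0..1}" "(s, \<phi> p) \<in> V" for s
    using V(4) that assms(2) W by (auto simp: chart_inverse[OF W(1)])
  have "continuous_on UNIV (\<lambda>s. (s, \<phi> p))"
    by (intro continuous_intros)
  then have "open ((\<lambda>s. (s, \<phi> p)) -` V)"
    using V(1) by (rule open_vimage[rotated])
  then have "\<forall>\<^sub>F s in at t within {0..1}. s \<in> (\<lambda>s. (s, \<phi> p)) -` V"
    using V(2) by (intro eventually_at_topological[THEN iffD2]) blast
  moreover have "\<forall>\<^sub>F s in at t within {0..1}. s \<in> {0..1::real}"
    by (simp add: eventually_at_filter)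
  ultimately have "\<forall>\<^sub>F s in at t within {0..1}. g (s, \<phi> p) = f s p"
    by eventually_elim (use eq in auto)
  then have "((\<lambda>s. f s p) has_derivative g') (at t within {0..1})"
    using eq[OF assms(3) V(2)] assms(3) by (rule has_derivative_transform_eventually[OF g'])
  then show ?thesis
    unfolding real_differentiable_def[symmetric] by (rule differentiableI)
qed

lemma bundle_endomorphism_linear: "bundle_endomorphism X A \<Longrightarrow> linear_on (fibre X p) (A p)"
  by (rule linear_onI) (simp_all add: bundle_endomorphism_def)

lemma endomorphism_in_fibre: "bundle_endomorphism X A \<Longrightarrow> u \<in> fibre X p \<Longrightarrow> A p u \<in> fibre X p"
  by (simp add: bundle_endomorphism_def)

lemma endomorphism_sections:
  "bundle_endomorphism X A \<Longrightarrow> s \<in> global_sections X \<Longrightarrow> (\<lambda>p. A p (s p)) \<in> global_sections X"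
  by (simp add: bundle_endomorphism_def)

text \<open>The frame at p does not move with s, so differentiating s |-> J_s u becomes a matter of
  real coefficients. Smoothness of the family is stated for sections, so u is first extended to
  one.\<close>

lemma endomorphism_family_curve:
  assumes J: "smooth_endomorphism_family X J" and F: "(W, k, b) \<in> frames X" "p \<in> W"
    and u: "u \<in> fibre X p" and t: "t \<in> {0..1}"
  obtains c c' where "\<forall>s\<in>{0..1}. J s p u = (\<Sum>i<k. c i s *\<^sub>R b i p)"
    "\<forall>i<k. (c i has_real_derivative c' i) (at t within {0..1})"
proof -
  obtain s where s: "s \<in> global_sections X" "s p = u"
    using ex_global_section[OF u] .
  then have "(\<lambda>t p. J t p (s p)) \<in> section_paths X UNIV"
    using J by (simp add: smooth_endomorphism_family_def)
  then have "\<exists>c. (\<forall>i<k. smooth_fun_path X (UNIV \<inter> W) (c i)) \<and>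
        (\<forall>t\<in>{0..1}. \<forall>p\<in>UNIV \<inter> W. J t p (s p) = (\<Sum>i<k. c i t p *\<^sub>R b i p))"
    using F(1) unfolding section_paths_def by blast
  then obtain c where c: "\<forall>i<k. smooth_fun_path X W (c i)"
    "\<forall>t\<in>{0..1}. \<forall>p\<in>W. J t p (s p) = (\<Sum>i<k. c i t p *\<^sub>R b i p)"
    by auto
  have "\<exists>D. ((\<lambda>s. c i s p) has_real_derivative D) (at t within {0..1})" if "i < k" for i
    using c(1) that smooth_fun_path_has_derivative[OF _ F(2) t] by simp
  then obtain c' where "\<And>i. i < k \<Longrightarrow> ((\<lambda>s. c i s p) has_real_derivative c' i) (at t within {0..1})"
    by metis
  with that[of "\<lambda>i s. c i s p" c'] c(2) s(2) F(2) show thesis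
    by auto
qed

text \<open>Used with constant v for J_s u, and with v = J_s b_i for J_s (J_s u).\<close>

lemma has_vector_derivative_combination:
  assumes "\<forall>i<k. (c i has_real_derivative c' i) (at t within S)"
    and "\<forall>i<k. (v i has_vector_derivative v' i) (at t within S)"
  shows "((\<lambda>s. \<Sum>i<k. c i s *\<^sub>R v i s) has_vector_derivative
     (\<Sum>i<(k::nat). c i t *\<^sub>R v' i + c' i *\<^sub>R v i t)) (at t within S)"
  using assms by (intro has_vector_derivative_sum has_vector_derivative_scaleR) auto

section \<open>The time derivative of J in a single fibre\<close>

context
  fixes J t
  assumes J: "smooth_endomorphism_family X J" and t: "t \<in> {0..1::real}"
begin

text \<open>Ensures uniqueness of derivatives within [0,1], also at its end points.\<close>

lemma unit_interval_not_bot: "at t within {0..1} \<noteq> bot"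
  using t by (simp add: trivial_limit_within islimpt_Icc)

lemma has_vector_derivative_cong_unit_interval:
  assumes "(f has_vector_derivative D) (at t within {0..1})" "\<And>s. s \<in> {0..1} \<Longrightarrow> g s = f s"
  shows "(g has_vector_derivative D) (at t within {0..1})"
  using t assms(2,1) by (rule has_vector_derivative_transform)

lemma time_deriv_eqI:
  assumes "((\<lambda>s. J s p u) has_vector_derivative D) (at t within {0..1})"
  shows "time_deriv J t p u = D"
  unfolding time_deriv_def using unit_interval_not_bot assms by (rule vector_derivative_within)

lemma time_deriv_works:
  assumes u: "u \<in> fibre X p"
  shows "((\<lambda>s. J s p u) has_vector_derivative time_deriv J t p u) (at t within {0..1})"
    and "time_deriv J t p u \<in> fibre X p"
proof -
  obtain W k b where F: "(W, k, b) \<in> frames X" "p \<in> W"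
    by (rule ex_frame)
  obtain c c' where c: "\<forall>s\<in>{0..1}. J s p u = (\<Sum>i<k. c i s *\<^sub>R b i p)"
    "\<forall>i<k. (c i has_real_derivative c' i) (at t within {0..1})"
    using endomorphism_family_curve[OF J F u t] .
  have "((\<lambda>s. \<Sum>i<k. c i s *\<^sub>R b i p) has_vector_derivative
      (\<Sum>i<k. c i t *\<^sub>R 0 + c' i *\<^sub>R b i p)) (at t within {0..1})"
    by (rule has_vector_derivative_combination[OF c(2)]) simp
  then have "((\<lambda>s. \<Sum>i<k. c i s *\<^sub>R b i p) has_vector_derivative (\<Sum>i<k. c' i *\<^sub>R b i p))
      (at t within {0..1})"
    by simp
  then have D: "((\<lambda>s. J s p u) has_vector_derivative (\<Sum>i<k. c' i *\<^sub>R b i p)) (at t within {0..1})"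
    by (rule has_vector_derivative_cong_unit_interval) (simp add: c(1))
  then have eq: "time_deriv J t p u = (\<Sum>i<k. c' i *\<^sub>R b i p)"
    by (rule time_deriv_eqI)
  show "((\<lambda>s. J s p u) has_vector_derivative time_deriv J t p u) (at t within {0..1})"
    using D unfolding eq .
  show "time_deriv J t p u \<in> fibre X p"
    unfolding eq using frame_in_fibre[OF F]
    by (intro subspace_sum subspace_scale fibre_subspace) simp
qed

lemma family_bundle_endomorphism: "s \<in> {0..1} \<Longrightarrow> bundle_endomorphism X (J s)"
  using J by (simp add: smooth_endomorphism_family_def)

lemma time_deriv_linear: "linear_on (fibre X p) (time_deriv J t p)"
proof (rule linear_onI)
  fix u v assume uv: "u \<in> fibre X p" "v \<in> fibre X p"
  show "time_deriv J t p (u + v) = time_deriv J t p u + time_deriv J t p v"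
  proof (rule time_deriv_eqI)
    show "((\<lambda>s. J s p (u + v)) has_vector_derivative time_deriv J t p u + time_deriv J t p v)
        (at t within {0..1})"
      by (rule has_vector_derivative_cong_unit_interval[OF
            has_vector_derivative_add[OF time_deriv_works(1)[OF uv(1)] time_deriv_works(1)[OF uv(2)]]])
        (simp add: linear_on_add[OF bundle_endomorphism_linear[OF family_bundle_endomorphism] uv])
  qed
next
  fix u and r :: real assume u: "u \<in> fibre X p"
  show "time_deriv J t p (r *\<^sub>R u) = r *\<^sub>R time_deriv J t p u"
  proof (rule time_deriv_eqI)
    have "((\<lambda>s. r *\<^sub>R J s p u) has_vector_derivative r *\<^sub>R time_deriv J t p u) (at t within {0..1})"
      using bounded_linear.has_vector_derivative[OF bounded_linear_scaleR_right time_deriv_works(1)[OF u]] .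
    then show "((\<lambda>s. J s p (r *\<^sub>R u)) has_vector_derivative r *\<^sub>R time_deriv J t p u)
        (at t within {0..1})"
      by (rule has_vector_derivative_cong_unit_interval)
        (simp add: linear_on_scale[OF bundle_endomorphism_linear[OF family_bundle_endomorphism] u])
  qed
qed

text \<open>Differentiate J_s (J_s u) = - u. Writing J_s u as the sum of c_i(s) b_i makes the left
  side the sum of c_i(s) J_s b_i; the terms with the derivative of J_s give dJ/dt (J u), those with
  c_i' give J (dJ/dt u), and together they vanish.\<close>

lemma time_deriv_anticommutes:
  assumes u: "u \<in> fibre X p" and sq: "\<And>s. s \<in> {0..1} \<Longrightarrow> J s p (J s p u) = - u"
  shows "time_deriv J t p (J t p u) = - J t p (time_deriv J t p u)"
proof -
  obtain W k b where F: "(W, k, b) \<in> frames X" "p \<in> W"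
    by (rule ex_frame)
  obtain c c' where c: "\<forall>s\<in>{0..1}. J s p u = (\<Sum>i<k. c i s *\<^sub>R b i p)"
    "\<forall>i<k. (c i has_real_derivative c' i) (at t within {0..1})"
    using endomorphism_family_curve[OF J F u t] .
  have b: "b i p \<in> fibre X p" if "i \<in> {..<k}" for i
    using frame_in_fibre[OF F] that by simp
  note lin = bundle_endomorphism_linear[OF family_bundle_endomorphism]
  note combination = linear_on_sum[where I = "{..<k}" and s = "\<lambda>i. b i p", OF _ fibre_subspace, OF _ b]
  have "((\<lambda>s. \<Sum>i<k. c i s *\<^sub>R b i p) has_vector_derivative
      (\<Sum>i<k. c i t *\<^sub>R 0 + c' i *\<^sub>R b i p)) (at t within {0..1})"
    by (rule has_vector_derivative_combination[OF c(2)]) simp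
  then have "((\<lambda>s. J s p u) has_vector_derivative (\<Sum>i<k. c i t *\<^sub>R 0 + c' i *\<^sub>R b i p)) (at t within {0..1})"
    by (rule has_vector_derivative_cong_unit_interval) (simp add: c(1))
  then have Du: "time_deriv J t p u = (\<Sum>i<k. c' i *\<^sub>R b i p)"
    using time_deriv_eqI by force
  have "((\<lambda>s. \<Sum>i<k. c i s *\<^sub>R J s p (b i p)) has_vector_derivative
      (\<Sum>i<k. c i t *\<^sub>R time_deriv J t p (b i p) + c' i *\<^sub>R J t p (b i p))) (at t within {0..1})"
    by (rule has_vector_derivative_combination[OF c(2)]) (simp add: b time_deriv_works(1))
  then have "((\<lambda>s. - u) has_vector_derivative
      (\<Sum>i<k. c i t *\<^sub>R time_deriv J t p (b i p) + c' i *\<^sub>R J t p (b i p))) (at t within {0..1})"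
  proof (rule has_vector_derivative_cong_unit_interval)
    fix s :: real assume s: "s \<in> {0..1}"
    have "(\<Sum>i<k. c i s *\<^sub>R J s p (b i p)) = J s p (\<Sum>i<k. c i s *\<^sub>R b i p)"
      by (rule combination[OF lin[OF s], symmetric])
    also have "\<dots> = J s p (J s p u)"
      by (simp only: bspec[OF c(1) s])
    finally show "- u = (\<Sum>i<k. c i s *\<^sub>R J s p (b i p))"
      by (simp only: sq[OF s])
  qed
  then have "(\<Sum>i<k. c i t *\<^sub>R time_deriv J t p (b i p) + c' i *\<^sub>R J t p (b i p)) = 0"
    using has_vector_derivative_const unit_interval_not_bot
    by (intro vector_derivative_unique_within[where f = "\<lambda>s. - u"])
  moreover have "time_deriv J t p (J t p u) = (\<Sum>i<k. c i t *\<^sub>R time_deriv J t p (b i p))"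
    by (simp only: bspec[OF c(1) t] combination[OF time_deriv_linear])
  moreover have "J t p (time_deriv J t p u) = (\<Sum>i<k. c' i *\<^sub>R J t p (b i p))"
    unfolding Du by (rule combination[OF lin[OF t]])
  ultimately show ?thesis
    by (simp add: sum.distrib eq_neg_iff_add_eq_0)
qed

end

end

section \<open>Courant algebroids\<close>

context courant_algebroid
begin

lemma fibre_uminus: "u \<in> fibre X p \<Longrightarrow> - u \<in> fibre X p"
  by (rule subspace_neg[OF fibre_subspace])

lemma fibre_add: "u \<in> fibre X p \<Longrightarrow> v \<in> fibre X p \<Longrightarrow> u + v \<in> fibre X p"
  by (rule subspace_add[OF fibre_subspace])

lemma fibre_diff: "u \<in> fibre X p \<Longrightarrow> v \<in> fibre X p \<Longrightarrow> u - v \<in> fibre X p"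
  by (rule subspace_diff[OF fibre_subspace])

lemma global_section_in_fibre: "s \<in> global_sections X \<Longrightarrow> s p \<in> fibre X p"
  by (erule sections_in_fibre) simp

lemma pairing_linear_left: "v \<in> fibre X p \<Longrightarrow> linear_on (fibre X p) (\<lambda>u. pairing X p u v)"
  by (rule linear_onI) (simp_all add: pairing_add pairing_scale)

lemma pairing_linear_right:
  assumes "u \<in> fibre X p" shows "linear_on (fibre X p) (pairing X p u)"
proof (rule linear_onI)
  fix v w assume "v \<in> fibre X p" "w \<in> fibre X p"
  then show "pairing X p u (v + w) = pairing X p u v + pairing X p u w"
    using assms pairing_add[of v p w u] pairing_sym[of u p] by (simp add: fibre_add)
next
  fix v and r :: real assume "v \<in> fibre X p"
  then show "pairing X p u (r *\<^sub>R v) = r *\<^sub>R pairing X p u v"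
    using assms pairing_scale[of v p u r] pairing_sym[of u p] subspace_scale[OF fibre_subspace] by simp
qed

lemma pairing_add_right:
  "u \<in> fibre X p \<Longrightarrow> v \<in> fibre X p \<Longrightarrow> w \<in> fibre X p \<Longrightarrow>
    pairing X p u (v + w) = pairing X p u v + pairing X p u w"
  by (rule linear_on_add[OF pairing_linear_right])

lemma pairing_uminus_left:
  "u \<in> fibre X p \<Longrightarrow> v \<in> fibre X p \<Longrightarrow> pairing X p (- u) v = - pairing X p u v"
  using linear_on_uminus[OF pairing_linear_left] .

lemma pairing_uminus_right:
  "u \<in> fibre X p \<Longrightarrow> v \<in> fibre X p \<Longrightarrow> pairing X p u (- v) = - pairing X p u v"
  by (rule linear_on_uminus[OF pairing_linear_right])

lemma pairing_diff_left:
  "u \<in> fibre X p \<Longrightarrow> v \<in> fibre X p \<Longrightarrow> w \<in> fibre X p \<Longrightarrow>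
    pairing X p (u - v) w = pairing X p u w - pairing X p v w"
  using pairing_add[of u p "- v" w] by (simp add: fibre_uminus pairing_uminus_left)

lemma pairing_diff_right:
  "u \<in> fibre X p \<Longrightarrow> v \<in> fibre X p \<Longrightarrow> w \<in> fibre X p \<Longrightarrow>
    pairing X p u (v - w) = pairing X p u v - pairing X p u w"
  using pairing_add_right[of u p v "- w"] by (simp add: fibre_uminus pairing_uminus_right)

lemmas pairing_algebra = pairing_add pairing_add_right pairing_diff_left pairing_diff_right
  pairing_uminus_left pairing_uminus_right

lemma pairing_sec_smooth:
  "a \<in> global_sections X \<Longrightarrow> b \<in> global_sections X \<Longrightarrow> smooth_fun X UNIV (pairing_sec X a b)"
  by (rule pairing_smooth) simp_all

lemma anchor_fun_add:
  assumes "u \<in> fibre X p" "smooth_fun X UNIV f" "smooth_fun X UNIV g"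
  shows "anchor X p u (\<lambda>q. f q + g q) = anchor X p u f + anchor X p u g"
  using anchor_tangent[OF assms(1)] assms(2,3) by (simp add: tangent_space_def)

lemma anchor_fun_uminus:
  assumes "u \<in> fibre X p" "smooth_fun X UNIV f"
  shows "anchor X p u (\<lambda>q. - f q) = - anchor X p u f"
proof -
  have "anchor X p u (\<lambda>q. (- 1) * f q) = (- 1) * anchor X p u f"
    using anchor_tangent[OF assms(1)] assms(2) unfolding tangent_space_def by blast
  then show ?thesis by simp
qed

lemma smooth_fun_uminus: "smooth_fun X UNIV f \<Longrightarrow> smooth_fun X UNIV (\<lambda>q. - f q :: real)"
  using smooth_fun_mult[OF smooth_fun_const, of UNIV f "- 1"] by simp

lemma anchor_fun_diff:
  assumes "u \<in> fibre X p" "smooth_fun X UNIV f" "smooth_fun X UNIV g"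
  shows "anchor X p u (\<lambda>q. f q - g q) = anchor X p u f - anchor X p u g"
  using anchor_fun_add[OF assms(1,2) smooth_fun_uminus[OF assms(3)]] anchor_fun_uminus[OF assms(1,3)]
  by simp

lemma pairing_eqI:
  assumes "u \<in> fibre X p" "v \<in> fibre X p" "\<And>a. a \<in> fibre X p \<Longrightarrow> pairing X p u a = pairing X p v a"
  shows "u = v"
  using pairing_nondegenerate[OF fibre_diff[OF assms(1,2)]] assms by (simp add: pairing_diff_left)

text \<open>The functionals <b_i, .> of a frame have trivial common kernel by nondegeneracy, so
  every functional is a combination of them.\<close>

lemma functional_is_pairing:
  assumes "linear_on (fibre X p) g"
  shows "\<exists>e\<in>fibre X p. \<forall>a\<in>fibre X p. pairing X p e a = g a"
proof -
  obtain W k b where F: "(W, k, b) \<in> frames X" "p \<in> W"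
    by (rule ex_frame)
  have b: "b i p \<in> fibre X p" if "i \<in> {..<k}" for i
    using frame_in_fibre[OF F] that by simp
  have "\<exists>c. \<forall>v\<in>fibre X p. g v = (\<Sum>i<k. c i * pairing X p (b i p) v)"
  proof (rule linear_functional_combination[OF fibre_subspace finite_lessThan _ assms])
    show "linear_on (fibre X p) (pairing X p (b i p))" if "i \<in> {..<k}" for i
      by (rule pairing_linear_right[OF b[OF that]])
    fix v assume v: "v \<in> fibre X p" "\<And>i. i \<in> {..<k} \<Longrightarrow> pairing X p (b i p) v = 0"
    have "pairing X p v a = 0" if a: "a \<in> fibre X p" for a
    proof -
      obtain c where c: "a = (\<Sum>i<k. c i *\<^sub>R b i p)"
        using frame_expansion[OF F a] .
      have "pairing X p a v = (\<Sum>i<k. c i *\<^sub>R pairing X p (b i p) v)"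
        unfolding c using linear_on_sum[OF pairing_linear_left[OF v(1)] fibre_subspace b] .
      also have "\<dots> = 0"
        using v(2) by simp
      finally show ?thesis
        using pairing_sym[OF a v(1)] by simp
    qed
    then have "v = 0"
      using pairing_nondegenerate[OF v(1)] by simp
    then show "g v = 0"
      using linear_on_scale[OF assms v(1), of 0] by simp
  qed
  then obtain c where c: "\<forall>v\<in>fibre X p. g v = (\<Sum>i<k. c i * pairing X p (b i p) v)" ..
  show ?thesis
  proof (intro bexI ballI)
    show "(\<Sum>i<k. c i *\<^sub>R b i p) \<in> fibre X p"
      using b by (intro subspace_sum subspace_scale fibre_subspace)
    show "pairing X p (\<Sum>i<k. c i *\<^sub>R b i p) a = g a" if "a \<in> fibre X p" for a
      using linear_on_sum[where f = "\<lambda>u. pairing X p u a" and I = "{..<k}" and s = "\<lambda>i. b i p",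
          OF pairing_linear_left[OF that] fibre_subspace b] c that by simp
  qed
qed

text \<open>The anchor is linear in the vector for every function f, so a |-> 1/2 rho(a) f is
  represented by a vector of the fibre, and only one by nondegeneracy; this is what the definite
  description requires.\<close>

lemma courant_D_works:
  shows courant_D_in_fibre: "courant_D X f p \<in> fibre X p"
    and pairing_courant_D: "a \<in> fibre X p \<Longrightarrow> pairing X p (courant_D X f p) a = 1/2 * anchor X p a f"
proof -
  have "linear_on (fibre X p) (\<lambda>a. 1/2 * anchor X p a f)"
    by (rule linear_onI) (simp_all add: anchor_add anchor_scale)
  then obtain e where
    e: "e \<in> fibre X p \<and> (\<forall>a\<in>fibre X p. pairing X p e a = 1/2 * anchor X p a f)"
    using functional_is_pairing by blast
  then have "\<exists>!e. e \<in> fibre X p \<and> (\<forall>a\<in>fibre X p. pairing X p e a = 1/2 * anchor X p a f)"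
    by (rule ex1I) (metis e pairing_eqI)
  from theI'[OF this] show "courant_D X f p \<in> fibre X p"
    and "a \<in> fibre X p \<Longrightarrow> pairing X p (courant_D X f p) a = 1/2 * anchor X p a f"
    unfolding courant_D_def by auto
qed

lemma courant_D_uminus:
  assumes "smooth_fun X UNIV f"
  shows "courant_D X (\<lambda>q. - f q) p = - courant_D X f p"
  using assms by (intro pairing_eqI[where p = p])
    (simp_all add: fibre_uminus courant_D_in_fibre pairing_uminus_left pairing_courant_D anchor_fun_uminus)

lemma bracket_uminus_right:
  assumes "a \<in> global_sections X" "b \<in> global_sections X"
  shows "bracket X a (\<lambda>q. - b q) p = - bracket X a b p"
proof -
  have "bracket X (\<lambda>q. - b q) a p = - bracket X b a p"
    using bracket_scale[OF assms(2,1), of "- 1" p] by simp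
  then show ?thesis
    using bracket_skew[OF assms, of p] bracket_skew[OF assms(1) sections_uminus[OF assms(2)], of p] by simp
qed

lemma bracket_uminus_left:
  assumes "a \<in> global_sections X" "b \<in> global_sections X"
  shows "bracket X (\<lambda>q. - a q) b p = - bracket X a b p"
  using bracket_scale[OF assms, of "- 1" p] by simp

lemma lie_deriv_in_fibre:
  "a \<in> global_sections X \<Longrightarrow> b \<in> global_sections X \<Longrightarrow> lie_deriv X a b p \<in> fibre X p"
  unfolding lie_deriv_def
  by (intro fibre_add courant_D_in_fibre global_section_in_fibre bracket_section)

lemma pairing_sec_uminus:
  assumes "a \<in> global_sections X" "b \<in> global_sections X"
  shows "pairing_sec X a (\<lambda>q. - b q) = (\<lambda>q. - pairing_sec X a b q)"
    and "pairing_sec X (\<lambda>q. - a q) b = (\<lambda>q. - pairing_sec X a b q)"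
  using assms by (auto simp: pairing_sec_def pairing_uminus_right pairing_uminus_left global_section_in_fibre)

lemma lie_deriv_uminus_right:
  assumes "a \<in> global_sections X" "b \<in> global_sections X"
  shows "lie_deriv X a (\<lambda>q. - b q) p = - lie_deriv X a b p"
  using assms by (simp add: lie_deriv_def bracket_uminus_right pairing_sec_uminus courant_D_uminus
      pairing_sec_smooth)

lemma lie_deriv_uminus_left:
  assumes "a \<in> global_sections X" "b \<in> global_sections X"
  shows "lie_deriv X (\<lambda>q. - a q) b p = - lie_deriv X a b p"
  using assms by (simp add: lie_deriv_def bracket_uminus_left pairing_sec_uminus courant_D_uminus
      pairing_sec_smooth)

lemma anchor_pairing:
  assumes "a \<in> global_sections X" "b \<in> global_sections X" "c \<in> global_sections X"
  shows "anchor X p (a p) (pairing_sec X b c)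
    = pairing X p (lie_deriv X a b p) (c p) + pairing X p (b p) (lie_deriv X a c p)"
  using pairing_invariant[OF assms, of p] by (simp add: anchor_sec_def lie_deriv_def)

text \<open>The skew brackets cancel in the symmetrized Dorfman bracket, leaving 2 D<a,b>; the 2
  absorbs the 1/2 in the definition of D.\<close>

lemma anchor_pairing_symmetrized:
  assumes "a \<in> global_sections X" "b \<in> global_sections X" "c \<in> global_sections X"
  shows "anchor X p (c p) (pairing_sec X a b)
    = pairing X p (lie_deriv X a b p) (c p) + pairing X p (lie_deriv X b a p) (c p)"
proof -
  have "pairing_sec X b a = pairing_sec X a b"
    using assms by (auto simp: pairing_sec_def pairing_sym global_section_in_fibre)
  then have "lie_deriv X a b p + lie_deriv X b a p
      = courant_D X (pairing_sec X a b) p + courant_D X (pairing_sec X a b) p"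
    using bracket_skew[OF assms(1,2), of p] by (simp add: lie_deriv_def)
  then have "pairing X p (lie_deriv X a b p + lie_deriv X b a p) (c p) = anchor X p (c p) (pairing_sec X a b)"
    using assms by (simp add: pairing_add courant_D_in_fibre pairing_courant_D global_section_in_fibre)
  then show ?thesis
    using assms by (simp add: pairing_add lie_deriv_in_fibre global_section_in_fibre)
qed

end

section \<open>The complexified Dorfman bracket\<close>

definition clie_deriv ::
  "('m, 'b, 'e::real_vector, 'z) courant_scheme \<Rightarrow> ('m \<Rightarrow> 'e \<times> 'e) \<Rightarrow> ('m \<Rightarrow> 'e \<times> 'e) \<Rightarrow> 'm \<Rightarrow> 'e \<times> 'e"
where
  "clie_deriv X s s' p =
     (lie_deriv X (fst \<circ> s) (fst \<circ> s') p - lie_deriv X (snd \<circ> s) (snd \<circ> s') p,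
      lie_deriv X (fst \<circ> s) (snd \<circ> s') p + lie_deriv X (snd \<circ> s) (fst \<circ> s') p)"

context courant_algebroid
begin

lemma csections_iff:
  "s \<in> csections X UNIV \<longleftrightarrow> fst \<circ> s \<in> global_sections X \<and> snd \<circ> s \<in> global_sections X"
  by (simp add: csections_def)

lemma csection_in_fibre:
  assumes "s \<in> csections X UNIV"
  shows "fst (s p) \<in> fibre X p" "snd (s p) \<in> fibre X p"
  using assms global_section_in_fibre[of "fst \<circ> s" p] global_section_in_fibre[of "snd \<circ> s" p]
  by (simp_all add: csections_iff)

text \<open>Breaks the complex expression into anchors of real pairings, the form in which the real
  identities apply.\<close>

lemma canchor_cpairing:
  assumes v: "v \<in> csections X UNIV" and s: "s \<in> csections X UNIV" and w: "w \<in> csections X UNIV"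
  shows "canchor_sec X v p (\<lambda>q. cpairing X q (s q) (w q))
    = Complex
       (anchor X p (fst (v p)) (pairing_sec X (fst \<circ> s) (fst \<circ> w))
         - anchor X p (fst (v p)) (pairing_sec X (snd \<circ> s) (snd \<circ> w))
         - (anchor X p (snd (v p)) (pairing_sec X (fst \<circ> s) (snd \<circ> w))
         + anchor X p (snd (v p)) (pairing_sec X (snd \<circ> s) (fst \<circ> w))))
       (anchor X p (fst (v p)) (pairing_sec X (fst \<circ> s) (snd \<circ> w))
         + anchor X p (fst (v p)) (pairing_sec X (snd \<circ> s) (fst \<circ> w))
         + (anchor X p (snd (v p)) (pairing_sec X (fst \<circ> s) (fst \<circ> w))
         - anchor X p (snd (v p)) (pairing_sec X (snd \<circ> s) (snd \<circ> w))))"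
proof -
  have Re: "Re \<circ> (\<lambda>q. cpairing X q (s q) (w q))
      = (\<lambda>q. pairing_sec X (fst \<circ> s) (fst \<circ> w) q - pairing_sec X (snd \<circ> s) (snd \<circ> w) q)"
    by (simp add: fun_eq_iff cpairing_def pairing_sec_def)
  have Im: "Im \<circ> (\<lambda>q. cpairing X q (s q) (w q))
      = (\<lambda>q. pairing_sec X (fst \<circ> s) (snd \<circ> w) q + pairing_sec X (snd \<circ> s) (fst \<circ> w) q)"
    by (simp add: fun_eq_iff cpairing_def pairing_sec_def)
  show ?thesis
    unfolding canchor_sec_def anchor_sec_def Re Im using s w csection_in_fibre[OF v, of p]
    by (simp add: anchor_fun_add anchor_fun_diff pairing_sec_smooth csections_iff)
qed

lemma canchor_cpairing_invariant:
  assumes v: "v \<in> csections X UNIV" and s: "s \<in> csections X UNIV" and w: "w \<in> csections X UNIV"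
  shows "canchor_sec X v p (\<lambda>q. cpairing X q (s q) (w q))
    = cpairing X p (clie_deriv X v s p) (w p) + cpairing X p (s p) (clie_deriv X v w p)"
proof -
  note sec = v[unfolded csections_iff] s[unfolded csections_iff] w[unfolded csections_iff]
  have anchor: "anchor X p (fst (v p)) (pairing_sec X b c)
      = pairing X p (lie_deriv X (fst \<circ> v) b p) (c p) + pairing X p (b p) (lie_deriv X (fst \<circ> v) c p)"
    "anchor X p (snd (v p)) (pairing_sec X b c)
      = pairing X p (lie_deriv X (snd \<circ> v) b p) (c p) + pairing X p (b p) (lie_deriv X (snd \<circ> v) c p)"
    if "b \<in> global_sections X" "c \<in> global_sections X" for b c
    using sec that anchor_pairing[of "fst \<circ> v" b c p] anchor_pairing[of "snd \<circ> v" b c p] by simp_all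
  show ?thesis
    unfolding canchor_cpairing[OF assms] complex_eq_iff
    using sec csection_in_fibre[OF v, of p] csection_in_fibre[OF s, of p] csection_in_fibre[OF w, of p]
    by (simp add: anchor cpairing_def clie_deriv_def pairing_algebra lie_deriv_in_fibre)
qed

lemma canchor_cpairing_symmetrized:
  assumes v: "v \<in> csections X UNIV" and s: "s \<in> csections X UNIV" and w: "w \<in> csections X UNIV"
  shows "canchor_sec X w p (\<lambda>q. cpairing X q (v q) (s q))
    = cpairing X p (clie_deriv X v s p) (w p) + cpairing X p (clie_deriv X s v p) (w p)"
proof -
  note sec = v[unfolded csections_iff] s[unfolded csections_iff] w[unfolded csections_iff]
  have anchor: "anchor X p (fst (w p)) (pairing_sec X a b)
      = pairing X p (lie_deriv X a b p) (fst (w p)) + pairing X p (lie_deriv X b a p) (fst (w p))"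
    "anchor X p (snd (w p)) (pairing_sec X a b)
      = pairing X p (lie_deriv X a b p) (snd (w p)) + pairing X p (lie_deriv X b a p) (snd (w p))"
    if "a \<in> global_sections X" "b \<in> global_sections X" for a b
    using sec that anchor_pairing_symmetrized[of a b "fst \<circ> w" p]
      anchor_pairing_symmetrized[of a b "snd \<circ> w" p] by simp_all
  show ?thesis
    unfolding canchor_cpairing[OF w v s] complex_eq_iff
    using sec csection_in_fibre[OF v, of p] csection_in_fibre[OF s, of p] csection_in_fibre[OF w, of p]
    by (simp add: anchor cpairing_def clie_deriv_def pairing_algebra lie_deriv_in_fibre)
qed

end

section \<open>The eigenbundle of a generalized complex structure\<close>

text \<open>Real and imaginary part of J e = i e. In particular e is determined by its real part u,
  as u - i J u.\<close>

lemma L_plus_iff: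
  "e \<in> L\<^sub>+ X J p \<longleftrightarrow> fst e \<in> fibre X p \<and> snd e \<in> fibre X p \<and>
    J p (fst e) = - snd e \<and> J p (snd e) = fst e"
  by (auto simp: eigenbundle_def cfibre_def cext_def cscale_def mem_Times_iff prod_eq_iff)

context courant_algebroid
begin

lemma canchor_sec_zero:
  assumes "s \<in> csections X UNIV"
  shows "canchor_sec X s p (\<lambda>q. 0) = 0"
proof -
  have "anchor X p u (\<lambda>q. 0) = 0" if "u \<in> fibre X p" for u
    using anchor_fun_diff[OF that smooth_fun_const smooth_fun_const, of 0 0] by simp
  then show ?thesis
    using csection_in_fibre[OF assms, of p]
    by (simp add: canchor_sec_def anchor_sec_def o_def complex_eq_iff)
qed

context
  fixes J
  assumes gc: "generalized_complex X J"
begin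

lemma gc_endomorphism: "bundle_endomorphism X J"
  using gc by (simp add: generalized_complex_def)

lemma gc_in_fibre: "u \<in> fibre X p \<Longrightarrow> J p u \<in> fibre X p"
  by (rule endomorphism_in_fibre[OF gc_endomorphism])

lemma gc_section: "s \<in> global_sections X \<Longrightarrow> (\<lambda>p. J p (s p)) \<in> global_sections X"
  by (rule endomorphism_sections[OF gc_endomorphism])

lemma gc_linear: "linear_on (fibre X p) (J p)"
  by (rule bundle_endomorphism_linear[OF gc_endomorphism])

lemma gc_square: "u \<in> fibre X p \<Longrightarrow> J p (J p u) = - u"
  using gc by (simp add: generalized_complex_def)

lemma gc_orthogonal:
  "u \<in> fibre X p \<Longrightarrow> v \<in> fibre X p \<Longrightarrow> pairing X p (J p u) (J p v) = pairing X p u v"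
  using gc by (simp add: generalized_complex_def)

lemma gc_skew:
  assumes "u \<in> fibre X p" "v \<in> fibre X p"
  shows "pairing X p u (J p v) = - pairing X p (J p u) v"
  using gc_orthogonal[OF assms(1) gc_in_fibre[OF assms(2)]] assms
  by (simp add: gc_square gc_in_fibre pairing_uminus_right)

lemma gc_integrable:
  assumes "x \<in> global_sections X" "y \<in> global_sections X"
  shows "bracket X (\<lambda>q. J q (x q)) (\<lambda>q. J q (y q)) p - bracket X x y p
    = J p (bracket X (\<lambda>q. J q (x q)) y p + bracket X x (\<lambda>q. J q (y q)) p)"
  using gc assms by (simp add: generalized_complex_def)

lemma L_section_csection: "v \<in> L_sections X J UNIV \<Longrightarrow> v \<in> csections X UNIV"
  by (simp add: L_sections_def)

lemma L_section_in_L: "v \<in> L_sections X J UNIV \<Longrightarrow> v p \<in> L\<^sub>+ X J p"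
  by (simp add: L_sections_def)

lemma L_section_fst: "v \<in> L_sections X J UNIV \<Longrightarrow> fst \<circ> v \<in> global_sections X"
  by (simp add: L_sections_def csections_iff)

lemma L_section_snd: "v \<in> L_sections X J UNIV \<Longrightarrow> snd \<circ> v = (\<lambda>q. - J q ((fst \<circ> v) q))"
  using L_section_in_L by (auto simp: L_plus_iff)

text \<open>The section y - i J y, twice the projection of y to L; these are the test sections of
  the final argument.\<close>

lemma L_section_of_real:
  assumes "y \<in> global_sections X"
  shows "(\<lambda>q. (y q, - J q (y q))) \<in> L_sections X J UNIV"
  using assms by (simp add: L_sections_def csections_iff o_def gc_section sections_uminus L_plus_iff
      global_section_in_fibre gc_in_fibre fibre_uminus gc_square linear_on_uminus[OF gc_linear])

text \<open><e, e'> = <J e, J e'> = i^2 <e, e'> = - <e, e'>, carried out on real and imaginary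
  parts.\<close>

lemma L_isotropic:
  assumes "e \<in> L\<^sub>+ X J p" "e' \<in> L\<^sub>+ X J p"
  shows "cpairing X p e e' = 0"
proof -
  have "pairing X p (fst e) (fst e') = pairing X p (snd e) (snd e')"
    using assms gc_orthogonal[of "snd e" p "snd e'"] by (simp add: L_plus_iff)
  moreover have "pairing X p (fst e) (snd e') = - pairing X p (snd e) (fst e')"
    using assms gc_orthogonal[of "fst e" p "snd e'"]
    by (simp add: L_plus_iff pairing_uminus_left fibre_uminus)
  ultimately show ?thesis
    by (simp add: cpairing_def complex_eq_iff)
qed

text \<open>For v = a - i J a and w = b - i J b the bracket is P + i Q with P and Q as below, and
  integrability of J for a and b reads - P = J (- Q).\<close>

lemma cbracket_in_L:
  assumes v: "v \<in> L_sections X J UNIV" and w: "w \<in> L_sections X J UNIV"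
  shows "cbracket X v w p \<in> L\<^sub>+ X J p"
proof -
  define a b where "a = fst \<circ> v" and "b = fst \<circ> w"
  have ab: "a \<in> global_sections X" "b \<in> global_sections X"
    "(\<lambda>q. J q (a q)) \<in> global_sections X" "(\<lambda>q. J q (b q)) \<in> global_sections X"
    using L_section_fst[OF v] L_section_fst[OF w] gc_section by (simp_all add: a_def b_def del: o_apply)
  define P where "P = bracket X a b p - bracket X (\<lambda>q. J q (a q)) (\<lambda>q. J q (b q)) p"
  define Q where "Q = - bracket X a (\<lambda>q. J q (b q)) p - bracket X (\<lambda>q. J q (a q)) b p"
  have fibre: "bracket X c d p \<in> fibre X p" if "c \<in> global_sections X" "d \<in> global_sections X" for c d
    using bracket_section[OF that] by (rule global_section_in_fibre)
  have "cbracket X v w p = (P, Q)"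
    unfolding cbracket_def L_section_snd[OF v] L_section_snd[OF w]
    unfolding a_def[symmetric] b_def[symmetric] P_def Q_def
    using ab by (simp add: bracket_uminus_left bracket_uminus_right sections_uminus)
  moreover have PQ: "P \<in> fibre X p" "Q \<in> fibre X p"
    using ab by (simp_all add: P_def Q_def fibre fibre_diff fibre_uminus)
  moreover have "P = J p Q"
  proof -
    have "- P = J p (- Q)"
      using gc_integrable[OF ab(1,2), of p] by (simp add: P_def Q_def add.commute)
    then show ?thesis
      using PQ by (simp add: linear_on_uminus[OF gc_linear])
  qed
  ultimately show ?thesis
    by (simp add: L_plus_iff gc_square)
qed

text \<open>The Dorfman and the skew bracket differ by D<v, w>, which is 0 since L is
  isotropic.\<close>

lemma clie_deriv_L_section:
  assumes v: "v \<in> L_sections X J UNIV" and w: "w \<in> L_sections X J UNIV"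
  shows "clie_deriv X v w p = cbracket X v w p"
proof -
  note sec = L_section_csection[OF v, unfolded csections_iff] L_section_csection[OF w, unfolded csections_iff]
  have "cpairing X q (v q) (w q) = 0" for q
    using L_isotropic L_section_in_L[OF v] L_section_in_L[OF w] .
  then have re: "pairing_sec X (fst \<circ> v) (fst \<circ> w) = pairing_sec X (snd \<circ> v) (snd \<circ> w)"
    and im: "pairing_sec X (fst \<circ> v) (snd \<circ> w) = (\<lambda>q. - pairing_sec X (snd \<circ> v) (fst \<circ> w) q)"
    by (auto simp: fun_eq_iff pairing_sec_def cpairing_def complex_eq_iff eq_neg_iff_add_eq_0)
  show ?thesis
    unfolding clie_deriv_def cbracket_def lie_deriv_def re im
    using sec by (simp add: courant_D_uminus pairing_sec_smooth)
qed

text \<open>The terms containing \<open>\<L>\<^sub>v s\<close> and \<open>\<L>\<^sub>v w\<close> cancel; what remains is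
  \<open>- \<langle>\<L>\<^sub>s v, w\<rangle>\<close>, which is moved to \<open>w\<close> because \<open>L\<close> is isotropic.\<close>

lemma L_differential_eq:
  assumes v: "v \<in> L_sections X J UNIV" and w: "w \<in> L_sections X J UNIV" and s: "s \<in> csections X UNIV"
    and \<beta>: "\<And>q e. e \<in> L\<^sub>+ X J q \<Longrightarrow> \<beta> q e = cpairing X q (s q) e"
  shows "L_differential X \<beta> v w p = cpairing X p (v p) (clie_deriv X s w p)"
proof -
  note cv = L_section_csection[OF v] and cw = L_section_csection[OF w]
  have "L_differential X \<beta> v w p = canchor_sec X v p (\<lambda>q. cpairing X q (s q) (w q))
      - canchor_sec X w p (\<lambda>q. cpairing X q (s q) (v q)) - cpairing X p (s p) (clie_deriv X v w p)"
    by (simp add: L_differential_def \<beta> L_section_in_L[OF v] L_section_in_L[OF w] cbracket_in_L[OF v w]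
        clie_deriv_L_section[OF v w])
  also have "\<dots> = - cpairing X p (clie_deriv X s v p) (w p)"
    unfolding canchor_cpairing_invariant[OF cv s cw] canchor_cpairing_symmetrized[OF s cv cw] by simp
  also have "\<dots> = cpairing X p (v p) (clie_deriv X s w p)"
  proof -
    have "(\<lambda>q. cpairing X q (v q) (w q)) = (\<lambda>q. 0)"
      using L_isotropic L_section_in_L[OF v] L_section_in_L[OF w] by blast
    then have "cpairing X p (clie_deriv X s v p) (w p) + cpairing X p (v p) (clie_deriv X s w p) = 0"
      using canchor_cpairing_invariant[OF s cv cw, of p] canchor_sec_zero[OF s] by simp
    then show ?thesis
      by (rule minus_unique)
  qed
  finally show ?thesis .
qed

lemma cconj_csection: "s \<in> csections X UNIV \<Longrightarrow> (\<lambda>q. cconj (s q)) \<in> csections X UNIV"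
  using sections_uminus[of "snd \<circ> s" UNIV] by (simp add: csections_iff cconj_def o_def)

lemma lie_deriv_endo_L_section:
  assumes w: "w \<in> L_sections X J UNIV" and x: "x \<in> global_sections X"
  shows "lie_deriv_endo X x J (fst \<circ> w) p = - lie_deriv X x (snd \<circ> w) p - J p (lie_deriv X x (fst \<circ> w) p)"
    and "lie_deriv_endo X x J (snd \<circ> w) p = lie_deriv X x (fst \<circ> w) p - J p (lie_deriv X x (snd \<circ> w) p)"
proof -
  have "(\<lambda>q. J q ((fst \<circ> w) q)) = (\<lambda>q. - (snd \<circ> w) q)" "(\<lambda>q. J q ((snd \<circ> w) q)) = fst \<circ> w"
    using L_section_in_L[OF w] by (auto simp: L_plus_iff)
  then show "lie_deriv_endo X x J (fst \<circ> w) p = - lie_deriv X x (snd \<circ> w) p - J p (lie_deriv X x (fst \<circ> w) p)"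
    and "lie_deriv_endo X x J (snd \<circ> w) p = lie_deriv X x (fst \<circ> w) p - J p (lie_deriv X x (snd \<circ> w) p)"
    using L_section_csection[OF w] x lie_deriv_uminus_right[of x "snd \<circ> w" p]
    unfolding lie_deriv_endo_def csections_iff by simp_all
qed

text \<open>With \<open>2 i x = z - cconj z\<close> the pairing with \<open>v\<close> equals \<open>2 i \<langle>v, \<L>\<^sub>x w\<rangle>\<close>, in which the
  contribution of \<open>z\<close> vanishes since \<open>L\<close> is isotropic and closed under the bracket.\<close>

lemma cpairing_lie_deriv_endo:
  assumes v: "v \<in> L_sections X J UNIV" and w: "w \<in> L_sections X J UNIV" and z: "z \<in> L_sections X J UNIV"
  shows "cpairing X p (v p)
      (lie_deriv_endo X (snd \<circ> z) J (fst \<circ> w) p, lie_deriv_endo X (snd \<circ> z) J (snd \<circ> w) p)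
    = - cpairing X p (v p) (clie_deriv X (\<lambda>q. cconj (z q)) w p)"
proof -
  note sec = L_section_csection[OF z, unfolded csections_iff] L_section_csection[OF w, unfolded csections_iff]
  define y1 y2 where "y1 = lie_deriv X (snd \<circ> z) (fst \<circ> w) p" and "y2 = lie_deriv X (snd \<circ> z) (snd \<circ> w) p"
  define A B where "A = lie_deriv X (fst \<circ> z) (fst \<circ> w) p" and "B = lie_deriv X (fst \<circ> z) (snd \<circ> w) p"
  have fibre: "y1 \<in> fibre X p" "y2 \<in> fibre X p" "A \<in> fibre X p" "B \<in> fibre X p"
    using sec by (simp_all add: y1_def y2_def A_def B_def lie_deriv_in_fibre)
  have vp: "fst (v p) \<in> fibre X p" "snd (v p) \<in> fibre X p" "J p (fst (v p)) = - snd (v p)"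
    "J p (snd (v p)) = fst (v p)"
    using L_section_in_L[OF v, of p] by (simp_all add: L_plus_iff)
  have conj: "fst \<circ> (\<lambda>q. cconj (z q)) = fst \<circ> z" "snd \<circ> (\<lambda>q. cconj (z q)) = (\<lambda>q. - (snd \<circ> z) q)"
    by (auto simp: cconj_def)
  have zbar: "clie_deriv X (\<lambda>q. cconj (z q)) w p = (A + y2, B - y1)"
    unfolding clie_deriv_def conj using sec lie_deriv_uminus_left[of "snd \<circ> z" _ p]
    by (simp add: y1_def y2_def A_def B_def)
  \<comment> \<open>This is <v, [z, w]> = 0. It eliminates A and B: modulo it, the derivative along
    the conjugate of z contributes 2 y2 - 2 i y1 = - 2 i (y1 + i y2), while J-skewness turns the
    left side of the claim into 2 i <v, y1 + i y2>.\<close>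
  have "cpairing X p (v p) (A - y2, B + y1) = 0"
    using L_isotropic[OF L_section_in_L[OF v] cbracket_in_L[OF z w]] clie_deriv_L_section[OF z w]
    by (simp add: clie_deriv_def y1_def y2_def A_def B_def)
  then show ?thesis
    unfolding zbar lie_deriv_endo_L_section[OF w sec(1)[THEN conjunct2]]
      y1_def[symmetric] y2_def[symmetric]
    using fibre vp by (simp add: cpairing_def complex_eq_iff pairing_algebra gc_skew gc_in_fibre fibre_uminus)
qed

end

end

section \<open>Equivalence of the two equations through the common defect \<open>T\<close>\<close>

theorem lemma4p3:
  fixes X :: "('m::{t2_space, second_countable_topology}, 'b::euclidean_space,
               'e::real_normed_vector) courant"
    and J :: "real \<Rightarrow> 'm \<Rightarrow> 'e \<Rightarrow> 'e"
    and \<beta> :: "real \<Rightarrow> 'm \<Rightarrow> 'e \<times> 'e \<Rightarrow> complex"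
    and z :: "real \<Rightarrow> 'm \<Rightarrow> 'e \<times> 'e"
    and x :: "real \<Rightarrow> 'm \<Rightarrow> 'e"
  assumes "courant_algebroid X"
    and "smooth_endomorphism_family X J"
    and "\<And>t. t \<in> {0..1} \<Longrightarrow> generalized_complex X (J t)"
    and "\<beta> \<in> L_dual_section_paths X J"
    and "\<And>t. t \<in> {0..1} \<Longrightarrow> z t \<in> L_sections X (J t) UNIV"
    and "\<And>t p e. t \<in> {0..1} \<Longrightarrow> e \<in> L\<^sub>+ X (J t) p \<Longrightarrow> \<beta> t p e = cpairing X p (cconj (z t p)) e"
    and "\<And>t p. t \<in> {0..1} \<Longrightarrow> cembed (x t p) = cscale (1 / (2 * \<i>)) (z t p - cconj (z t p))"
  shows "(\<forall>t\<in>{0..1}. \<forall>v\<in>L_sections X (J t) UNIV. \<forall>w\<in>L_sections X (J t) UNIV. \<forall>p.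
            omega_dot X J t v w p = L_differential X (\<beta> t) v w p) \<longleftrightarrow>
         (\<forall>t\<in>{0..1}. \<forall>y\<in>global_sections X. \<forall>p.
            time_deriv J t p (y p) + lie_deriv_endo X (x t) (J t) y p = 0)"
proof -
  interpret courant_algebroid X by fact
  define T where "T t y p = time_deriv J t p (y p) + lie_deriv_endo X (x t) (J t) y p" for t y p
  have x: "x t = snd \<circ> z t" if "t \<in> {0..1}" for t
  proof
    fix p
    \<comment> \<open>z - cconj z is the pair (0, 2 snd z), and multiplication by - i/2 turns it
      into (snd z, 0).\<close>
    have "1 / (2 * \<i>) = Complex 0 (- (1 / 2))"
      by (simp add: complex_eq_iff Re_divide Im_divide)
    then show "x t p = (snd \<circ> z t) p"
      using assms(7)[OF that, of p]
      by (simp add: cembed_def cscale_def cconj_def scaleR_2[symmetric])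
  qed
  have x_section: "x t \<in> global_sections X" if t: "t \<in> {0..1}" for t
    using assms(5)[OF t] x[OF t] by (simp add: L_sections_def csections_iff)
  have square: "J s p (J s p u) = - u" if "s \<in> {0..1}" "u \<in> fibre X p" for s p u
    using gc_square[OF assms(3)] that .
  have endo_fibre: "lie_deriv_endo X (x t) (J t) y p \<in> fibre X p"
    if "t \<in> {0..1}" "y \<in> global_sections X" for t y p
    unfolding lie_deriv_endo_def
    using that x_section[OF that(1)] gc_section[OF assms(3)[OF that(1)]] gc_in_fibre[OF assms(3)[OF that(1)]]
    by (intro fibre_diff) (simp_all add: lie_deriv_in_fibre)
  have T_fibre: "T t y p \<in> fibre X p" if "t \<in> {0..1}" "y \<in> global_sections X" for t y p
    unfolding T_def using endo_fibre[OF that] time_deriv_works(2)[OF assms(2) that(1)]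
      global_section_in_fibre[OF that(2)] by (simp add: fibre_add)
  \<comment> \<open>The defect of the first equation is the pairing of v with the complex extension
    of \<open>T\<close>, the defect of the second.\<close>
  have pairing_T: "omega_dot X J t v w p - L_differential X (\<beta> t) v w p
      = cpairing X p (v p) (T t (fst \<circ> w) p, T t (snd \<circ> w) p)"
    if t: "t \<in> {0..1}" and v: "v \<in> L_sections X (J t) UNIV" and w: "w \<in> L_sections X (J t) UNIV"
    for t v w p
  proof -
    note gc = assms(3)[OF t]
    note z = assms(5)[OF t]
    have w': "fst \<circ> w \<in> global_sections X" "snd \<circ> w \<in> global_sections X"
      using L_section_csection[OF gc w] by (simp_all add: csections_iff)
    have "L_differential X (\<beta> t) v w p = cpairing X p (v p) (clie_deriv X (\<lambda>q. cconj (z t q)) w p)"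
      using L_differential_eq[OF gc v w cconj_csection[OF gc L_section_csection[OF gc z]] assms(6)[OF t]] .
    also have "\<dots> = - cpairing X p (v p)
        (lie_deriv_endo X (x t) (J t) (fst \<circ> w) p, lie_deriv_endo X (x t) (J t) (snd \<circ> w) p)"
      unfolding x[OF t] cpairing_lie_deriv_endo[OF gc v w z] by simp
    finally show ?thesis
      using csection_in_fibre[OF L_section_csection[OF gc v], of p]
        csection_in_fibre[OF L_section_csection[OF gc w], of p]
        endo_fibre[OF t w'(1), of p] endo_fibre[OF t w'(2), of p] time_deriv_works(2)[OF assms(2) t]
      by (simp add: omega_dot_def cext_def T_def cpairing_def complex_eq_iff pairing_add_right)
  qed
  have T_anticommutes: "T t (\<lambda>q. - J t q (y q)) p = J t p (T t y p)"
    if t: "t \<in> {0..1}" and y: "y \<in> global_sections X" for t y p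
  proof -
    note gc = assms(3)[OF t]
    note w = L_section_of_real[OF gc y]
    have yp: "y p \<in> fibre X p"
      by (rule global_section_in_fibre[OF y])
    have "time_deriv J t p (- J t p (y p)) = J t p (time_deriv J t p (y p))"
      using time_deriv_anticommutes[OF assms(2) t yp square[OF _ yp]]
        linear_on_uminus[OF time_deriv_linear[OF assms(2) t] gc_in_fibre[OF gc yp]] by simp
    moreover have "lie_deriv_endo X (x t) (J t) (\<lambda>q. - J t q (y q)) p
        = J t p (lie_deriv_endo X (x t) (J t) y p)"
    proof -
      define y1 y2 where "y1 = lie_deriv X (x t) y p" and "y2 = lie_deriv X (x t) (\<lambda>q. - J t q (y q)) p"
      have fibre: "y1 \<in> fibre X p" "y2 \<in> fibre X p"
        using x_section[OF t] y gc_section[OF gc y]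
        by (simp_all add: y1_def y2_def lie_deriv_in_fibre sections_uminus)
      \<comment> \<open>As y2 is the derivative of - J y, the argument of J on the left is the Lie
        derivative of J at y; the right side is the one at - J y, because J maps - J y back to
        y.\<close>
      have "J t p (- y2 - J t p y1) = y1 - J t p y2"
        using linear_on_add[OF gc_linear[OF gc], of "- y2" p "- J t p y1"] fibre square[OF t fibre(1)]
        by (simp add: linear_on_uminus[OF gc_linear[OF gc]] fibre_uminus gc_in_fibre[OF gc])
      then show ?thesis
        using lie_deriv_endo_L_section[OF gc w x_section[OF t], of p]
        by (simp add: o_def y1_def y2_def)
    qed
    ultimately show ?thesis
      unfolding T_def using linear_on_add[OF gc_linear[OF gc]] endo_fibre[OF t y]
        time_deriv_works(2)[OF assms(2) t yp] by simp
  qed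
  show ?thesis
    unfolding T_def[symmetric]
  proof (intro iffI ballI allI)
    fix t :: real and y p
    assume eq: "\<forall>t\<in>{0..1}. \<forall>v\<in>L_sections X (J t) UNIV. \<forall>w\<in>L_sections X (J t) UNIV. \<forall>p.
            omega_dot X J t v w p = L_differential X (\<beta> t) v w p"
      and t: "t \<in> {0..1}" and y: "y \<in> global_sections X"
    note gc = assms(3)[OF t]
    show "T t y p = 0"
    proof (rule pairing_nondegenerate[OF T_fibre[OF t y]])
      fix u assume u: "u \<in> fibre X p"
      obtain s where s: "s \<in> global_sections X" "s p = u"
        using ex_global_section[OF u] .
      \<comment> \<open>Only the real part matters: orthogonality of J makes it 2 <u, T y>.\<close>
      have "cpairing X p (s p, - J t p (s p)) (T t y p, J t p (T t y p)) = 0"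
        using pairing_T[OF t L_section_of_real[OF gc s(1)] L_section_of_real[OF gc y], of p] eq t
          L_section_of_real[OF gc s(1)] L_section_of_real[OF gc y]
        by (simp add: o_def T_anticommutes[OF t y])
      then have "pairing X p u (T t y p) = 0"
        using s(2) u T_fibre[OF t y, of p] gc_orthogonal[OF gc u T_fibre[OF t y]]
        by (simp add: cpairing_def complex_eq_iff pairing_uminus_left gc_in_fibre[OF gc])
      then show "pairing X p (T t y p) u = 0"
        using pairing_sym[OF u T_fibre[OF t y]] by simp
    qed
  next
    fix t :: real and v w p
    assume T: "\<forall>t\<in>{0..1}. \<forall>y\<in>global_sections X. \<forall>p. T t y p = 0"
      and t: "t \<in> {0..1}" and v: "v \<in> L_sections X (J t) UNIV" and w: "w \<in> L_sections X (J t) UNIV"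
    note gc = assms(3)[OF t]
    have "T t (fst \<circ> w) p = 0" "T t (snd \<circ> w) p = 0"
      using T t L_section_csection[OF gc w] by (auto simp: csections_iff)
    moreover have "cpairing X p e (0, 0) = 0" if "e \<in> cfibre X p" for e
      using that linear_on_scale[OF pairing_linear_right, of _ p 0 0] subspace_0[OF fibre_subspace, of p]
      by (auto simp: cpairing_def complex_eq_iff cfibre_def)
    moreover have "v p \<in> cfibre X p"
      using L_section_in_L[OF gc v] by (simp add: eigenbundle_def)
    ultimately show "omega_dot X J t v w p = L_differential X (\<beta> t) v w p"
      using pairing_T[OF t v w, of p] by simp
  qed
qed

end
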